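(* Let $D$ be a division ring whose center $k$ has characteristic different from $2$, and let $\ast$ be a $k$-involution on $D$. Let $N$ be a normal subgroup of the multiplicative group $D^{\bullet}=D\setminus\{0\}$, and assume that $N$ contains a torsion-free nilpotent-by-finite subgroup $G$ which is not abelian-by-finite. If $G^\ast=G$ and $N^\ast=N$, then $N$ contains a free symmetric pair with respect to $\ast$, i.e. there exist $u,v\in N$ with $u^\ast=u$, $v^\ast=v$ such that $u,v$ generate a free subgroup of rank $2$ of $D^\bullet$.
   Context: A $k$-involution on a $k$-algebra $R$ is a $k$-linear map $\ast$ with $(xy)^\ast=y^\ast x^\ast$ and $(x^\ast)^\ast=x$ for all $x,y\in R$. A group is nilpotent-by-finite (resp. abelian-by-finite) if it has a nilpotent (resp. abelian) subgroup of finite index. *)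

theory Defs
  imports Main
begin

definition center :: "'a::division_ring set" where
  "center = {c. \<forall>x. c * x = x * c}"

definition k_involution :: "('a::division_ring \<Rightarrow> 'a) \<Rightarrow> bool" where
  "k_involution s \<longleftrightarrow>
     (\<forall>x y. s (x + y) = s x + s y) \<and>
     (\<forall>c\<in>center. \<forall>x. s (c * x) = c * s x) \<and>
     (\<forall>x y. s (x * y) = s y * s x) \<and>
     (\<forall>x. s (s x) = x)"

definition units_mult :: "'a::division_ring set" where
  "units_mult = {x. x \<noteq> 0}"

definition is_subgroup :: "'a::division_ring set \<Rightarrow> bool" where
  "is_subgroup H \<longleftrightarrow> H \<subseteq> units_mult \<and> 1 \<in> H \<and>
     (\<forall>x\<in>H. \<forall>y\<in>H. x * y \<in> H) \<and> (\<forall>x\<in>H. inverse x \<in> H)"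

definition is_normal_subgroup :: "'a::division_ring set \<Rightarrow> bool" where
  "is_normal_subgroup N \<longleftrightarrow> is_subgroup N \<and>
     (\<forall>d\<in>units_mult. \<forall>x\<in>N. inverse d * x * d \<in> N)"

inductive_set gen_subgroup :: "'a::division_ring set \<Rightarrow> 'a set" for S where
  one: "1 \<in> gen_subgroup S"
| gen: "x \<in> S \<Longrightarrow> x \<in> gen_subgroup S"
| inv: "x \<in> S \<Longrightarrow> inverse x \<in> gen_subgroup S"
| mult: "x \<in> gen_subgroup S \<Longrightarrow> y \<in> gen_subgroup S \<Longrightarrow> x * y \<in> gen_subgroup S"

definition commutator :: "'a::division_ring \<Rightarrow> 'a \<Rightarrow> 'a" where
  "commutator x y = inverse x * inverse y * x * y"

fun lower_central :: "'a::division_ring set \<Rightarrow> nat \<Rightarrow> 'a set" where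
  "lower_central H 0 = H"
| "lower_central H (Suc n) =
     gen_subgroup {commutator x y | x y. x \<in> lower_central H n \<and> y \<in> H}"

definition nilpotent_sg :: "'a::division_ring set \<Rightarrow> bool" where
  "nilpotent_sg H \<longleftrightarrow> (\<exists>n. lower_central H n = {1})"

definition abelian_sg :: "'a::division_ring set \<Rightarrow> bool" where
  "abelian_sg H \<longleftrightarrow> (\<forall>x\<in>H. \<forall>y\<in>H. x * y = y * x)"

definition finite_index :: "'a::division_ring set \<Rightarrow> 'a set \<Rightarrow> bool" where
  "finite_index H G \<longleftrightarrow> finite {{h * g | h. h \<in> H} | g. g \<in> G}"

definition nilpotent_by_finite :: "'a::division_ring set \<Rightarrow> bool" where
  "nilpotent_by_finite G \<longleftrightarrow>
     (\<exists>H. is_subgroup H \<and> H \<subseteq> G \<and> nilpotent_sg H \<and> finite_index H G)"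

definition abelian_by_finite :: "'a::division_ring set \<Rightarrow> bool" where
  "abelian_by_finite G \<longleftrightarrow>
     (\<exists>H. is_subgroup H \<and> H \<subseteq> G \<and> abelian_sg H \<and> finite_index H G)"

definition torsion_free :: "'a::division_ring set \<Rightarrow> bool" where
  "torsion_free G \<longleftrightarrow> (\<forall>g\<in>G. \<forall>n::nat. n > 0 \<and> g ^ n = 1 \<longrightarrow> g = 1)"

fun eval_word :: "'a::division_ring \<Rightarrow> 'a \<Rightarrow> (bool \<times> bool) list \<Rightarrow> 'a" where
  "eval_word u v [] = 1"
| "eval_word u v ((l, e) # w) =
     (let g = (if l then v else u) in if e then inverse g else g) * eval_word u v w"

fun reduced_word :: "(bool \<times> bool) list \<Rightarrow> bool" where
  "reduced_word ((l1, e1) # (l2, e2) # w) =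
     (\<not> (l1 = l2 \<and> e1 \<noteq> e2) \<and> reduced_word ((l2, e2) # w))"
| "reduced_word _ = True"

definition free_pair :: "'a::division_ring \<Rightarrow> 'a \<Rightarrow> bool" where
  "free_pair u v \<longleftrightarrow> u \<noteq> 0 \<and> v \<noteq> 0 \<and>
     (\<forall>w. reduced_word w \<and> w \<noteq> [] \<longrightarrow> eval_word u v w \<noteq> 1)"

end

theory Submission
  imports Defs "HOL-Computational_Algebra.Polynomial"
begin

text \<open>
  A nonabelian nilpotent subgroup of \<open>G\<close> stable under \<open>*\<close> contains \<open>x\<close>, \<open>y\<close> with
  \<open>y x = z x y\<close>, where \<open>z\<close> has infinite order and commutes with both, and with
  \<open>x* = x\<close> or \<open>x\<^sup>-\<^sup>1\<close>, \<open>y* = y\<close> or \<open>y\<^sup>-\<^sup>1\<close>. Put \<open>g = (1 - x)\<^sup>-\<^sup>1 (1 - z x)\<close>, a commutator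
  of \<open>1 - x\<close> and \<open>y\<close>, hence in \<open>N\<close>, and \<open>d = (1 - y) (1 + y)\<^sup>-\<^sup>1\<close>, so that \<open>d*\<close> is \<open>d\<close> or \<open>-d\<close>.
  If \<open>c = d g d\<^sup>-\<^sup>1\<close> and \<open>c*\<close> generate a free group of rank 2, then \<open>c* c\<close> and \<open>c c*\<close> are a free
  symmetric pair, and conjugation by \<open>d\<close> reduces this to the pair \<open>g*\<close>, \<open>d\<^sup>2 g d\<^sup>-\<^sup>2\<close>.

  Let \<open>F\<close> be the field of rational functions in \<open>x\<close> over \<open>\<int>[z]\<close>, \<open>\<sigma>\<close> the conjugation by \<open>y\<close>, and
  \<open>T\<^sub>\<epsilon> = (1 - \<epsilon> y)\<^sup>-\<^sup>1\<close> for \<open>\<epsilon> = 1, -1\<close>. Since \<open>d\<^sup>2\<close> and \<open>d\<^sup>-\<^sup>2\<close> are quadratic polynomials in \<open>T\<^sub>-\<^sub>1\<close>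
  and \<open>T\<^sub>1\<close>, a word in the pair expands into products \<open>b\<^sub>0 T b\<^sub>1 T b\<^sub>2 \<dots>\<close> with coefficients in \<open>F\<close>. As with
  iterated integrals, the longest product is not an \<open>F\<close>-combination of shorter ones as soon as
  no coefficient between \<open>T\<^sub>\<epsilon>\<close> and \<open>T\<^sub>\<delta>\<close> has the form \<open>f - \<epsilon> \<delta> \<sigma>(f)\<close>. For the coefficient \<open>1\<close>
  between equal signs this is seen at \<open>x = 0\<close>; a nonzero power of \<open>g\<close> or \<open>g*\<close>
  has exactly one pole in the orbit \<open>{z\<^sup>i}\<close>, whereas \<open>f + \<sigma>(f)\<close> has none or at least two.
\<close>

section \<open>Words\<close>

lemma eval_word_conj:
  assumes "h \<noteq> 0"
  shows "eval_word (h * u * inverse h) (h * v * inverse h) w = h * eval_word u v w * inverse h"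
proof (induction u v w rule: eval_word.induct)
  case (1 u v)
  then show ?case using assms by simp
next
  case (2 u v l e w)
  have inv_conj: "inverse (h * g * inverse h) = h * inverse g * inverse h" for g
    using assms by (cases "g = 0") (simp_all add: nonzero_inverse_mult_distrib mult.assoc)
  have "h * a * inverse h * (h * b * inverse h) = h * (a * b) * inverse h" for a b
    using assms by (simp add: mult.assoc) (simp add: mult.assoc[symmetric])
  then show ?case using 2 by (auto simp: Let_def inv_conj)
qed

lemma free_pair_conj:
  assumes "free_pair (h * u * inverse h) (h * v * inverse h)" and "h \<noteq> 0"
  shows "free_pair u v"
  using assms by (auto simp: free_pair_def eval_word_conj)

text \<open>The substitution \<open>u = a b\<close>, \<open>v = b a\<close>: no letters cancel in the image of a reduced word.\<close>

fun swap_subst :: "(bool \<times> bool) list \<Rightarrow> (bool \<times> bool) list" where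
  "swap_subst [] = []"
| "swap_subst ((l, e) # w) = (l \<noteq> e, e) # (l = e, e) # swap_subst w"

lemma reduced_word_swap_subst: "reduced_word w \<Longrightarrow> reduced_word (swap_subst w)"
  by (induction w rule: reduced_word.induct) auto

lemma eval_word_swap_subst:
  assumes "a \<noteq> 0" "b \<noteq> 0"
  shows "eval_word a b (swap_subst w) = eval_word (a * b) (b * a) w"
  using assms
  by (induction w rule: swap_subst.induct)
    (auto simp: Let_def nonzero_inverse_mult_distrib mult.assoc)

lemma free_pair_mult_swap:
  assumes "free_pair a b"
  shows "free_pair (a * b) (b * a)"
proof -
  have "eval_word (a * b) (b * a) w \<noteq> 1" if "reduced_word w" "w \<noteq> []" for w
  proof -
    have "swap_subst w \<noteq> []" using that(2) by (cases w) auto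
    then show ?thesis
      using assms reduced_word_swap_subst[OF that(1)]
      by (metis free_pair_def eval_word_swap_subst)
  qed
  then show ?thesis using assms by (auto simp: free_pair_def)
qed

section \<open>Words in inverses of linear skew polynomials\<close>

text \<open>\<open>F\<close> and \<open>y\<close> generate a skew polynomial ring F[y; \<sigma>]
  twisted by conjugation with \<open>y\<close>. \<open>one_not_coboundary\<close> is the coefficient
  condition of the overview for the coefficient 1 between equal signs, a situation that squares of
  Cayley transforms produce.\<close>

locale skew_extension =
  fixes F :: "'a::division_ring set" and y :: 'a
  assumes zero_F: "0 \<in> F" and one_F: "1 \<in> F"
    and add_F: "\<lbrakk>f \<in> F; g \<in> F\<rbrakk> \<Longrightarrow> f + g \<in> F"
    and uminus_F: "f \<in> F \<Longrightarrow> - f \<in> F"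
    and mult_F: "\<lbrakk>f \<in> F; g \<in> F\<rbrakk> \<Longrightarrow> f * g \<in> F"
    and inverse_F: "f \<in> F \<Longrightarrow> inverse f \<in> F"
    and y_nonzero: "y \<noteq> 0"
    and conj_F: "f \<in> F \<Longrightarrow> y * f * inverse y \<in> F"
    and powers_independent:
      "\<lbrakk>\<And>i. c i \<in> F; (\<Sum>i\<le>n. c i * y ^ i) = 0; i \<le> n\<rbrakk> \<Longrightarrow> c i = 0"
    and two_nonzero: "(1::'a) + 1 \<noteq> 0"
    and one_not_coboundary: "f \<in> F \<Longrightarrow> f - y * f * inverse y \<noteq> 1"
begin

definition \<sigma> :: "'a \<Rightarrow> 'a" where "\<sigma> f = y * f * inverse y"

lemma y_mult: "y * (f * a) = \<sigma> f * (y * a)"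
  using y_nonzero by (simp add: \<sigma>_def mult.assoc) (simp add: mult.assoc[symmetric])

lemma \<sigma>_F: "f \<in> F \<Longrightarrow> \<sigma> f \<in> F"
  by (simp add: \<sigma>_def conj_F)

lemma \<sigma>_add: "\<sigma> (f + g) = \<sigma> f + \<sigma> g"
  by (simp add: \<sigma>_def distrib_left distrib_right)

lemma \<sigma>_zero [simp]: "\<sigma> 0 = 0" and \<sigma>_one [simp]: "\<sigma> 1 = 1"
  using y_nonzero by (simp_all add: \<sigma>_def)

lemma \<sigma>_eq_0_iff: "\<sigma> f = 0 \<longleftrightarrow> f = 0"
  using y_nonzero by (simp add: \<sigma>_def)

lemma diff_F: "\<lbrakk>f \<in> F; g \<in> F\<rbrakk> \<Longrightarrow> f - g \<in> F"
  using add_F[of f "- g"] uminus_F[of g] by simp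

section \<open>Signs, and left modules over the skew polynomial ring\<close>

definition signs :: "'a set" where "signs = {1, -1}"

lemma sign_cases: "\<epsilon> \<in> signs \<Longrightarrow> \<epsilon> = 1 \<or> \<epsilon> = -1"
  by (simp add: signs_def)

lemma sign_F: "\<epsilon> \<in> signs \<Longrightarrow> \<epsilon> \<in> F"
  by (auto simp: signs_def one_F uminus_F)

lemma sign_commute: "\<epsilon> \<in> signs \<Longrightarrow> a * (\<epsilon> * b) = \<epsilon> * (a * b)"
  by (auto simp: signs_def)

lemma uminus_sign: "\<epsilon> \<in> signs \<Longrightarrow> - \<epsilon> \<in> signs"
  by (auto simp: signs_def)

text \<open>These are the left F[y; \<sigma>]-submodules of the division ring; they serve as
  moduli.\<close>

definition stable_subspace :: "'a set \<Rightarrow> bool" where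
  "stable_subspace V \<longleftrightarrow> 0 \<in> V \<and> (\<forall>u\<in>V. \<forall>v\<in>V. u + v \<in> V) \<and>
     (\<forall>f\<in>F. \<forall>v\<in>V. f * v \<in> V) \<and> (\<forall>v\<in>V. y * v \<in> V)"

lemma stable_subspaceI:
  "\<lbrakk>0 \<in> V; \<And>u v. \<lbrakk>u \<in> V; v \<in> V\<rbrakk> \<Longrightarrow> u + v \<in> V; \<And>f v. \<lbrakk>f \<in> F; v \<in> V\<rbrakk> \<Longrightarrow> f * v \<in> V;
    \<And>v. v \<in> V \<Longrightarrow> y * v \<in> V\<rbrakk> \<Longrightarrow> stable_subspace V"
  by (simp add: stable_subspace_def)

lemma stable_subspaceD:
  assumes "stable_subspace V"
  shows "0 \<in> V" "\<lbrakk>u \<in> V; v \<in> V\<rbrakk> \<Longrightarrow> u + v \<in> V" "\<lbrakk>f \<in> F; v \<in> V\<rbrakk> \<Longrightarrow> f * v \<in> V"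
    "v \<in> V \<Longrightarrow> y * v \<in> V" "v \<in> V \<Longrightarrow> - v \<in> V" "\<lbrakk>u \<in> V; v \<in> V\<rbrakk> \<Longrightarrow> u - v \<in> V"
proof -
  show a: "0 \<in> V" "\<lbrakk>u \<in> V; v \<in> V\<rbrakk> \<Longrightarrow> u + v \<in> V" "\<lbrakk>f \<in> F; v \<in> V\<rbrakk> \<Longrightarrow> f * v \<in> V"
    "v \<in> V \<Longrightarrow> y * v \<in> V" for u v f
    using assms unfolding stable_subspace_def by blast+
  show m: "v \<in> V \<Longrightarrow> - v \<in> V" for v
    using a(3)[of "-1" v] uminus_F[OF one_F] by simp
  show "\<lbrakk>u \<in> V; v \<in> V\<rbrakk> \<Longrightarrow> u - v \<in> V"
    using a(2)[of u "- v"] m[of v] by simp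
qed

text \<open>A list rather than a finite set, so that \<open>coefficient_is_coboundary\<close> can
  remove one vector at a time from a possibly dependent family.\<close>

definition lin_comb :: "('a \<times> 'a) list \<Rightarrow> 'a" where
  "lin_comb l = (\<Sum>(f, e)\<leftarrow>l. f * e)"

lemma lin_comb_simps [simp]:
  "lin_comb [] = 0" "lin_comb ((f, e) # l) = f * e + lin_comb l"
  "lin_comb (l @ l') = lin_comb l + lin_comb l'"
  by (simp_all add: lin_comb_def)

text \<open>Modulo \<open>V\<close> the vector \<open>e\<close> is an eigenvector, so
  \<open>y * (g * e)\<close> is \<open>(\<sigma> g * \<delta>) * e\<close> up to an element of
  \<open>V\<close>.\<close>

lemma stable_subspace_insert:
  assumes V: "stable_subspace V" and e: "y * e - \<delta> * e \<in> V" and \<delta>: "\<delta> \<in> signs"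
  shows "stable_subspace {v + g * e | v g. v \<in> V \<and> g \<in> F}" (is "stable_subspace ?W")
proof -
  note D = stable_subspaceD[OF V]
  have WI: "a \<in> ?W" if "a = v + g * e" "v \<in> V" "g \<in> F" for a v g
    using that by blast
  have "0 \<in> ?W" by (rule WI[of _ 0 0]) (auto simp: D zero_F)
  moreover have "u + v \<in> ?W" if uv: "u \<in> ?W" "v \<in> ?W" for u v
  proof -
    obtain a g b h where *: "u = a + g * e" "a \<in> V" "g \<in> F" "v = b + h * e" "b \<in> V" "h \<in> F"
      using uv by blast
    show ?thesis
      by (rule WI[of _ "a + b" "g + h"]) (auto simp: * D add_F distrib_right)
  qed
  moreover have "f * v \<in> ?W" if f: "f \<in> F" and v: "v \<in> ?W" for f v
  proof -
    obtain b h where *: "v = b + h * e" "b \<in> V" "h \<in> F"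
      using v by blast
    show ?thesis
      by (rule WI[of _ "f * b" "f * h"]) (auto simp: * D mult_F f distrib_left mult.assoc)
  qed
  moreover have "y * v \<in> ?W" if v: "v \<in> ?W" for v
  proof -
    obtain b h where *: "v = b + h * e" "b \<in> V" "h \<in> F"
      using v by blast
    have "y * v = (y * b + \<sigma> h * (y * e - \<delta> * e)) + (\<sigma> h * \<delta>) * e"
      by (simp add: *(1) distrib_left y_mult right_diff_distrib mult.assoc)
    then show ?thesis
      by (rule WI) (auto intro!: D e mult_F \<sigma>_F sign_F[OF \<delta>] *)
  qed
  ultimately show ?thesis by (rule stable_subspaceI)
qed

text \<open>Modulo \<open>V\<close>, left multiplication by \<open>y\<close> is \<open>\<sigma>\<close>-semilinear and the vectors \<open>t\<close> and \<open>e\<close>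
  are eigenvectors; if they were independent over \<open>F\<close>, one would just compare the
  coefficients at \<open>t\<close>.\<close>

lemma coefficient_is_coboundary:
  assumes "stable_subspace V" "t \<notin> V" "y * t - \<epsilon>' * t \<in> V" "\<epsilon> \<in> signs" "\<epsilon>' \<in> signs"
    "\<forall>(f, e) \<in> set l. f \<in> F \<and> (\<exists>\<delta>\<in>signs. y * e - \<delta> * e \<in> V)"
    "b \<in> F" "v \<in> V" "s = v + lin_comb l" "b * t - (s - \<epsilon> * (y * s)) \<in> V"
  shows "\<exists>f\<in>F. b = f - \<epsilon> * \<epsilon>' * \<sigma> f"
  using assms
proof (induction l arbitrary: V v b s)
  case Nil
  note D = stable_subspaceD[OF Nil(1)]
  \<comment> \<open>With no vectors left, \<open>s\<close> lies in \<open>V\<close>, hence so does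
    \<open>b * t\<close>; an invertible \<open>b\<close> would then put \<open>t\<close> into
    \<open>V\<close>.\<close>
  have "s - \<epsilon> * (y * s) \<in> V" using Nil by (auto intro!: D sign_F)
  then have bt: "b * t \<in> V" using D(2) Nil.prems(10) by fastforce
  have "b = 0"
  proof (rule ccontr)
    assume b: "b \<noteq> 0"
    have "inverse b * (b * t) \<in> V" using bt Nil by (auto intro!: D inverse_F)
    then show False using b Nil(2) by (simp add: mult.assoc[symmetric])
  qed
  then show ?case using zero_F by (auto intro!: bexI[of _ 0])
next
  case (Cons fe l)
  obtain f e where fe: "fe = (f, e)" by (cases fe)
  note D = stable_subspaceD[OF Cons.prems(1)]
  obtain \<delta> where f: "f \<in> F" and \<delta>: "\<delta> \<in> signs" "y * e - \<delta> * e \<in> V"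
    using Cons.prems(6) fe by auto
  define W where "W = {v + g * e | v g. v \<in> V \<and> g \<in> F}"
  have W: "stable_subspace W"
    unfolding W_def by (rule stable_subspace_insert[OF Cons.prems(1) \<delta>(2,1)])
  have "a + 0 * e \<in> W" if "a \<in> V" for a using that zero_F unfolding W_def by blast
  then have VW: "V \<subseteq> W" by auto
  \<comment> \<open>As long as \<open>t\<close> stays outside \<open>W\<close>, \<open>e\<close> is
    absorbed into the modulus. Once \<open>t\<close> lies in \<open>W\<close>, it has a nonzero
    component along \<open>e\<close>, and \<open>e\<close> can be traded for
    \<open>t\<close>.\<close>
  show ?case
  proof (cases "t \<in> W")
    case False
    show ?thesis
    proof (rule Cons.IH[OF W False])
      show "v + f * e \<in> W" using Cons.prems(8) f unfolding W_def by blast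
      show "s = v + f * e + lin_comb l" using Cons.prems(9) fe by (simp add: add.assoc)
      show "\<forall>(f, e)\<in>set l. f \<in> F \<and> (\<exists>\<delta>\<in>signs. y * e - \<delta> * e \<in> W)"
        using Cons.prems(6) VW by fastforce
    qed (use Cons.prems VW in auto)
  next
    case True
    then obtain v1 g where t: "t = v1 + g * e" "v1 \<in> V" "g \<in> F" unfolding W_def by blast
    have g: "g \<noteq> 0" using t Cons.prems(2) by auto
    define k where "k = f * inverse g"
    have k: "k \<in> F" by (simp add: k_def f t mult_F inverse_F)
    have fe': "f * e = k * t - k * v1"
      using g by (simp add: t(1) k_def distrib_left mult.assoc) (simp add: mult.assoc[symmetric])
    \<comment> \<open>Splitting \<open>k * t\<close> off from \<open>s\<close> changes the
      coefficient of \<open>t\<close> by \<open>k - \<epsilon> * \<epsilon>' * \<sigma> k\<close>,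
      which already has the desired form; what remains involves the shorter list.\<close>
    define s' where "s' = (v - k * v1) + lin_comb l"
    have s: "s = s' + k * t" using Cons.prems(9) fe fe' by (simp add: s'_def)
    define b' where "b' = b - (k - \<epsilon> * \<epsilon>' * \<sigma> k)"
    have "b' * t - (s' - \<epsilon> * (y * s'))
        = b * t - (s - \<epsilon> * (y * s)) - \<epsilon> * (\<sigma> k * (y * t - \<epsilon>' * t))"
      by (simp add: b'_def s algebra_simps y_mult[of k] sign_commute[OF Cons.prems(5), of "\<sigma> k" t])
    also have "\<dots> \<in> V"
      by (rule D(6)[OF Cons.prems(10) D(3)[OF sign_F[OF Cons.prems(4)] D(3)[OF \<sigma>_F[OF k] Cons.prems(3)]]])
    finally have mem: "b' * t - (s' - \<epsilon> * (y * s')) \<in> V" .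
    have "\<exists>f\<in>F. b' = f - \<epsilon> * \<epsilon>' * \<sigma> f"
    proof (rule Cons.IH[OF Cons.prems(1-5) _ _ _ s'_def mem])
      show "v - k * v1 \<in> V" using Cons.prems(8) by (intro D k t)
      show "b' \<in> F" unfolding b'_def
        by (intro diff_F mult_F \<sigma>_F k Cons.prems(7) sign_F[OF Cons.prems(4)] sign_F[OF Cons.prems(5)])
    qed (use Cons.prems in auto)
    then obtain f' where "f' \<in> F" "b' = f' - \<epsilon> * \<epsilon>' * \<sigma> f'" by blast
    then have "b = (f' + k) - \<epsilon> * \<epsilon>' * \<sigma> (f' + k)" "f' + k \<in> F"
      using k add_F by (auto simp: b'_def \<sigma>_add algebra_simps)
    then show ?thesis by blast
  qed
qed

section \<open>The filtration by the number of inverted linear factors\<close>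

definition T :: "'a \<Rightarrow> 'a" where "T \<epsilon> = inverse (1 - \<epsilon> * y)"

text \<open>\<open>S n\<close> is spanned over \<open>F\<close> by the products with at most
  \<open>n\<close> factors \<open>T \<epsilon>\<close>, ending on the right in a skew
  polynomial.\<close>

primrec S :: "nat \<Rightarrow> 'a set" where
  "S 0 = {\<Sum>i\<le>n. c i * y ^ i | n c. \<forall>i. c i \<in> F}"
| "S (Suc n) = {v + lin_comb l | v l.
     v \<in> S n \<and> set l \<subseteq> F \<times> {T \<epsilon> * s | \<epsilon> s. \<epsilon> \<in> signs \<and> s \<in> S n}}"

lemma linear_nonzero: "\<epsilon> \<in> signs \<Longrightarrow> 1 - \<epsilon> * y \<noteq> 0"
  using powers_independent[of "\<lambda>i. if i = 0 then 1 else - \<epsilon>", of 1 0]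
  by (fastforce simp: one_F uminus_F sign_F)

lemma T_cancel: "\<epsilon> \<in> signs \<Longrightarrow> (1 - \<epsilon> * y) * (T \<epsilon> * a) = a"
  using linear_nonzero by (simp add: T_def mult.assoc[symmetric])

text \<open>Because \<open>\<epsilon>\<close> squares to 1, \<open>T \<epsilon> * a\<close> is an
  eigenvector of \<open>y\<close> up to a multiple of \<open>a\<close>. This makes every
  \<open>S n\<close> stable under \<open>y\<close> and supplies the eigenvectors for
  \<open>coefficient_is_coboundary\<close>.\<close>

lemma y_T: "\<epsilon> \<in> signs \<Longrightarrow> y * (T \<epsilon> * a) = \<epsilon> * (T \<epsilon> * a) - \<epsilon> * a"
  using T_cancel[of \<epsilon> a] sign_cases[of \<epsilon>] by (auto simp: algebra_simps)

lemma S_0I: "(\<And>i. c i \<in> F) \<Longrightarrow> (\<Sum>i\<le>n. c i * y ^ i) \<in> S 0"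
  by auto

lemma y_mult_sum:
  "y * (\<Sum>i\<le>n. c i * y ^ i) = (\<Sum>i\<le>Suc n. (case i of 0 \<Rightarrow> 0 | Suc j \<Rightarrow> \<sigma> (c j)) * y ^ i)"
proof -
  have "y * (c i * y ^ i) = \<sigma> (c i) * y ^ Suc i" for i
    by (simp add: y_mult)
  then show ?thesis
    unfolding sum_distrib_left sum.atMost_Suc_shift by simp
qed

lemma stable_S_0: "stable_subspace (S 0)"
proof -
  have "0 \<in> S 0" using S_0I[of "\<lambda>_. 0" 0] zero_F by simp
  moreover have "u + v \<in> S 0" if uv: "u \<in> S 0" "v \<in> S 0" for u v
  proof -
    obtain m c n d where *: "u = (\<Sum>i\<le>m. c i * y ^ i)" "\<forall>i. c i \<in> F"
      "v = (\<Sum>i\<le>n. d i * y ^ i)" "\<forall>i. d i \<in> F"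
      using uv by auto
    have pad: "(\<Sum>i\<le>k. c i * y ^ i) = (\<Sum>i\<le>max m n. (if i \<le> k then c i else 0) * y ^ i)"
      if "k \<le> max m n" for k and c :: "nat \<Rightarrow> 'a"
      using that by (intro sum.mono_neutral_cong_left) auto
    have "u + v = (\<Sum>i\<le>max m n. ((if i \<le> m then c i else 0) + (if i \<le> n then d i else 0)) * y ^ i)"
      unfolding *(1,3) pad[of m c, OF max.cobounded1] pad[of n d, OF max.cobounded2]
      by (simp only: sum.distrib distrib_right)
    then show ?thesis using *(2,4) zero_F add_F by (simp del: S.simps) (rule S_0I, auto)
  qed
  moreover have "f * v \<in> S 0" if f: "f \<in> F" and v: "v \<in> S 0" for f v
  proof -
    obtain n d where *: "v = (\<Sum>i\<le>n. d i * y ^ i)" "\<forall>i. d i \<in> F"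
      using v by auto
    have "f * v = (\<Sum>i\<le>n. (f * d i) * y ^ i)" by (simp add: * sum_distrib_left mult.assoc)
    then show ?thesis using f * mult_F by (simp del: S.simps) (rule S_0I, auto)
  qed
  moreover have "y * v \<in> S 0" if v: "v \<in> S 0" for v
  proof -
    obtain n d where *: "v = (\<Sum>i\<le>n. d i * y ^ i)" "\<forall>i. d i \<in> F"
      using v by auto
    have "y * v = (\<Sum>i\<le>Suc n. (case i of 0 \<Rightarrow> 0 | Suc j \<Rightarrow> \<sigma> (d j)) * y ^ i)"
      by (simp only: * y_mult_sum)
    also have "\<dots> \<in> S 0"
      by (rule S_0I) (use * zero_F \<sigma>_F in \<open>auto split: nat.splits\<close>)
    finally show ?thesis .
  qed
  ultimately show ?thesis by (rule stable_subspaceI)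
qed

lemma S_SucI:
  "\<lbrakk>v \<in> S n; set l \<subseteq> F \<times> {T \<epsilon> * s | \<epsilon> s. \<epsilon> \<in> signs \<and> s \<in> S n}; a = v + lin_comb l\<rbrakk>
    \<Longrightarrow> a \<in> S (Suc n)"
  by auto

lemma S_mono: "S n \<subseteq> S (Suc n)"
  by (auto simp del: S.simps intro!: S_SucI[of _ _ "[]"])

lemma stable_S: "stable_subspace (S n)"
proof (induction n)
  case 0
  show ?case by (rule stable_S_0)
next
  case (Suc n)
  note D = stable_subspaceD[OF Suc]
  let ?E = "{T \<epsilon> * s | \<epsilon> s. \<epsilon> \<in> signs \<and> s \<in> S n}"
  have "0 \<in> S (Suc n)" using D(1) S_mono by blast
  moreover have "u + v \<in> S (Suc n)" if uv: "u \<in> S (Suc n)" "v \<in> S (Suc n)" for u v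
  proof -
    obtain a l b k where *: "u = a + lin_comb l" "a \<in> S n" "set l \<subseteq> F \<times> ?E"
      "v = b + lin_comb k" "b \<in> S n" "set k \<subseteq> F \<times> ?E"
      using uv unfolding S.simps by blast
    show ?thesis
      by (rule S_SucI[of "a + b" _ "l @ k"]) (use * D in auto)
  qed
  moreover have "f * v \<in> S (Suc n)" if f: "f \<in> F" and v: "v \<in> S (Suc n)" for f v
  proof -
    obtain b k where *: "v = b + lin_comb k" "b \<in> S n" "set k \<subseteq> F \<times> ?E"
      using v unfolding S.simps by blast
    have "f * lin_comb k = lin_comb (map (\<lambda>(g, e). (f * g, e)) k)"
      by (induction k) (auto simp: distrib_left mult.assoc)
    then show ?thesis
      by (intro S_SucI[of "f * b" _ "map (\<lambda>(g, e). (f * g, e)) k"])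
        (use * f D mult_F in \<open>auto simp: distrib_left\<close>)
  qed
  moreover have "y * v \<in> S (Suc n)" if v: "v \<in> S (Suc n)" for v
  proof -
    obtain b k where *: "v = b + lin_comb k" "b \<in> S n" "set k \<subseteq> F \<times> ?E"
      using v unfolding S.simps by blast
    from *(3) have "y * lin_comb k \<in> S (Suc n)"
    proof (induction k)
      case Nil
      then show ?case using calculation(1) by simp
    next
      case (Cons fe k)
      obtain f \<epsilon> s where fe: "fe = (f, T \<epsilon> * s)" "f \<in> F" "\<epsilon> \<in> signs" "s \<in> S n"
        using Cons.prems by auto
      have "\<sigma> f * (\<epsilon> * (T \<epsilon> * s) - \<epsilon> * s) = - (\<sigma> f * (\<epsilon> * s)) + lin_comb [(\<sigma> f * \<epsilon>, T \<epsilon> * s)]"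
        by (simp add: right_diff_distrib mult.assoc)
      then have "\<sigma> f * (\<epsilon> * (T \<epsilon> * s) - \<epsilon> * s) \<in> S (Suc n)"
        by (rule S_SucI[rotated 2])
          (use fe in \<open>auto intro!: D mult_F \<sigma>_F sign_F[OF fe(3)]\<close>)
      then have "y * (f * (T \<epsilon> * s)) \<in> S (Suc n)"
        by (simp only: y_mult[of f] y_T[OF fe(3)])
      then show ?case using Cons calculation(2) by (auto simp: fe(1) distrib_left simp del: S.simps)
    qed
    moreover have "y * b \<in> S (Suc n)" using D(4)[OF *(2)] S_mono by blast
    ultimately show ?thesis using \<open>\<And>u v. \<lbrakk>u \<in> S (Suc n); v \<in> S (Suc n)\<rbrakk> \<Longrightarrow> u + v \<in> S (Suc n)\<close>
      by (simp add: *(1) distrib_left del: S.simps)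
  qed
  ultimately show ?case by (rule stable_subspaceI)
qed

lemma T_S: "\<lbrakk>\<epsilon> \<in> signs; s \<in> S n\<rbrakk> \<Longrightarrow> T \<epsilon> * s \<in> S (Suc n)"
  by (rule S_SucI[of 0 _ "[(1, T \<epsilon> * s)]"]) (use stable_subspaceD(1)[OF stable_S] one_F in auto)

lemma F_S: "f \<in> F \<Longrightarrow> f \<in> S n"
proof (induction n)
  case 0
  then show ?case using S_0I[of "\<lambda>_. f" 0] by simp
next
  case (Suc n)
  then show ?case using S_mono by blast
qed

text \<open>Degree count: the product has the coefficient
  \<open>- (\<epsilon> * \<sigma> (c n))\<close> in degree n + 1 > 0, so it lies in \<open>F\<close>
  only if \<open>c n\<close> vanishes. The induction then drops the top term.\<close>

lemma linear_mult_in_F: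
  assumes "\<epsilon> \<in> signs" "\<forall>i. c i \<in> F" "(1 - \<epsilon> * y) * (\<Sum>i\<le>n. c i * y ^ i) \<in> F"
  shows "(\<Sum>i\<le>n. c i * y ^ i) = 0"
  using assms(3)
proof (induction n)
  case 0
  define b where "b = (1 - \<epsilon> * y) * c 0"
  have b: "b \<in> F" using 0 by (simp add: b_def)
  have "y * c 0 = \<sigma> (c 0) * y" using y_mult[of "c 0" 1] by simp
  then have "b = c 0 - \<epsilon> * (\<sigma> (c 0) * y)"
    by (simp add: b_def left_diff_distrib mult.assoc)
  then have "(\<Sum>i\<le>1. (if i = 0 then c 0 - b else - (\<epsilon> * \<sigma> (c 0))) * y ^ i) = 0"
    by (simp add: mult.assoc)
  from powers_independent[OF _ this, of 1] have "\<epsilon> * \<sigma> (c 0) = 0"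
    using assms(1,2) b by (auto simp: diff_F uminus_F mult_F sign_F \<sigma>_F)
  then show ?case using sign_cases[OF assms(1)] by (auto simp: \<sigma>_eq_0_iff)
next
  case (Suc n)
  define s where "s = (\<Sum>i\<le>Suc n. c i * y ^ i)"
  define b where "b = (1 - \<epsilon> * y) * s"
  have b: "b \<in> F" using Suc by (simp add: b_def s_def)
  define d where "d i = (case i of 0 \<Rightarrow> c 0 - b
    | Suc j \<Rightarrow> (if j \<le> n then c (Suc j) else 0) - \<epsilon> * \<sigma> (c j))" for i
  have "y * s = (\<Sum>i\<le>Suc (Suc n). (case i of 0 \<Rightarrow> 0 | Suc j \<Rightarrow> \<sigma> (c j)) * y ^ i)"
    by (simp only: s_def y_mult_sum)
  then have ys: "\<epsilon> * (y * s) = (\<Sum>i\<le>Suc (Suc n). (case i of 0 \<Rightarrow> 0 | Suc j \<Rightarrow> \<epsilon> * \<sigma> (c j)) * y ^ i)"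
    by (simp only: sum_distrib_left) (rule sum.cong, auto simp: mult.assoc split: nat.splits)
  have ss: "s - b = (\<Sum>i\<le>Suc (Suc n). (case i of 0 \<Rightarrow> c 0 - b
      | Suc j \<Rightarrow> (if j \<le> n then c (Suc j) else 0)) * y ^ i)"
    unfolding s_def by (subst (1 2) sum.atMost_Suc_shift) simp
  have "(\<Sum>i\<le>Suc (Suc n). d i * y ^ i) = (s - b) - \<epsilon> * (y * s)"
    unfolding ss ys sum_subtractf[symmetric]
    by (rule sum.cong) (auto simp: d_def left_diff_distrib split: nat.splits)
  also have "\<dots> = 0" by (simp add: b_def left_diff_distrib mult.assoc)
  finally have *: "(\<Sum>i\<le>Suc (Suc n). d i * y ^ i) = 0" .
  have "d i \<in> F" for i
    using assms(1,2) b by (auto simp: d_def split: nat.splits intro!: diff_F uminus_F mult_F sign_F[OF assms(1)] \<sigma>_F zero_F)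
  from powers_independent[OF this *, of "Suc (Suc n)"] have "\<epsilon> * \<sigma> (c (Suc n)) = 0"
    by (simp add: d_def)
  then have "c (Suc n) = 0" using sign_cases[OF assms(1)] by (auto simp: \<sigma>_eq_0_iff)
  then show ?case using Suc by simp
qed

text \<open>A vector that is new at level \<open>Suc n\<close> and whose class modulo
  \<open>S n\<close> is an eigenvector of \<open>y\<close>; in the products below,
  \<open>\<epsilon>\<close> is the sign of the leftmost factor \<open>T\<close>.\<close>

definition leading :: "nat \<Rightarrow> 'a \<Rightarrow> 'a \<Rightarrow> bool" where
  "leading n \<epsilon> t \<longleftrightarrow> t \<in> S (Suc n) \<and> t \<notin> S n \<and> y * t - \<epsilon> * t \<in> S n"

text \<open>Were \<open>T \<epsilon> * b\<close> a skew polynomial, its product with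
  \<open>1 - \<epsilon> * y\<close> would be the nonzero constant \<open>b\<close>, against
  \<open>linear_mult_in_F\<close>.\<close>

lemma leading_0:
  assumes "\<epsilon> \<in> signs" "b \<in> F" "b \<noteq> 0"
  shows "leading 0 \<epsilon> (T \<epsilon> * b)"
proof -
  have "T \<epsilon> * b \<notin> S 0"
  proof
    assume "T \<epsilon> * b \<in> S 0"
    then obtain n c where c: "T \<epsilon> * b = (\<Sum>i\<le>n. c i * y ^ i)" "\<forall>i. c i \<in> F" by auto
    have "(1 - \<epsilon> * y) * (\<Sum>i\<le>n. c i * y ^ i) = b"
      using T_cancel[OF assms(1)] by (simp add: c(1)[symmetric])
    with linear_mult_in_F[OF assms(1) c(2)] assms show False by force
  qed
  moreover have "y * (T \<epsilon> * b) - \<epsilon> * (T \<epsilon> * b) \<in> S 0"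
    unfolding y_T[OF assms(1)]
    using F_S[OF uminus_F[OF mult_F[OF sign_F[OF assms(1)] assms(2)]]] by (simp del: S.simps)
  ultimately show ?thesis
    using T_S[OF assms(1) F_S[OF assms(2)]] by (simp add: leading_def del: S.simps)
qed

text \<open>Multiplication by \<open>1 - \<epsilon> * y\<close> turns the new vector into
  \<open>b * t\<close>. If the vector lay in \<open>S (Suc n)\<close>, it would be a combination of
  eigenvectors modulo \<open>S n\<close>, and \<open>coefficient_is_coboundary\<close> would give
  \<open>b\<close> the excluded form.\<close>

lemma leading_Suc:
  assumes t: "leading n \<epsilon>' t" and \<epsilon>: "\<epsilon> \<in> signs" "\<epsilon>' \<in> signs" and b: "b \<in> F"
    and nb: "\<And>f. f \<in> F \<Longrightarrow> b \<noteq> f - \<epsilon> * \<epsilon>' * \<sigma> f"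
  shows "leading (Suc n) \<epsilon> (T \<epsilon> * (b * t))"
proof -
  note D = stable_subspaceD[OF stable_S]
  have bt: "b * t \<in> S (Suc n)" using t b D unfolding leading_def by blast
  have "T \<epsilon> * (b * t) \<notin> S (Suc n)"
  proof
    assume "T \<epsilon> * (b * t) \<in> S (Suc n)"
    then obtain v l where l: "T \<epsilon> * (b * t) = v + lin_comb l" "v \<in> S n"
      "set l \<subseteq> F \<times> {T \<epsilon> * s | \<epsilon> s. \<epsilon> \<in> signs \<and> s \<in> S n}"
      unfolding S.simps by blast
    have "\<exists>f\<in>F. b = f - \<epsilon> * \<epsilon>' * \<sigma> f"
    proof (rule coefficient_is_coboundary[OF stable_S[of n] _ _ \<epsilon> _ b l(2,1)])
      show "t \<notin> S n" "y * t - \<epsilon>' * t \<in> S n" using t by (auto simp: leading_def)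
      have "y * (T \<delta> * s) - \<delta> * (T \<delta> * s) \<in> S n" if "\<delta> \<in> signs" "s \<in> S n" for \<delta> s
        unfolding y_T[OF that(1)] using D(5)[OF D(3)[OF sign_F[OF that(1)] that(2)]] by simp
      then show "\<forall>(f, e)\<in>set l. f \<in> F \<and> (\<exists>\<delta>\<in>signs. y * e - \<delta> * e \<in> S n)"
        using l(3) by fastforce
      have "T \<epsilon> * (b * t) - \<epsilon> * (y * (T \<epsilon> * (b * t))) = b * t"
        using T_cancel[OF \<epsilon>(1), of "b * t"] by (simp add: left_diff_distrib mult.assoc)
      then show "b * t - (T \<epsilon> * (b * t) - \<epsilon> * (y * (T \<epsilon> * (b * t)))) \<in> S n"
        using D(1) by simp
    qed
    then show False using nb by blast
  qed
  moreover have "y * (T \<epsilon> * (b * t)) - \<epsilon> * (T \<epsilon> * (b * t)) \<in> S (Suc n)"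
    unfolding y_T[OF \<epsilon>(1)] using D(5)[OF D(3)[OF sign_F[OF \<epsilon>(1)] bt]] by simp
  ultimately show ?thesis using T_S[OF \<epsilon>(1) bt] by (simp add: leading_def)
qed

text \<open>Carries the result for \<open>T \<epsilon> * (T \<epsilon> * a)\<close> over to a
  quadratic polynomial in \<open>T \<epsilon>\<close>; \<open>\<sigma> k = k\<close> preserves the
  eigenvalue.\<close>

lemma leading_mod:
  assumes t: "leading n \<epsilon> t" and k: "k \<in> F" "k \<noteq> 0" "\<sigma> k = k" and u: "u \<in> S n"
    and \<epsilon>: "\<epsilon> \<in> signs"
  shows "leading n \<epsilon> (k * t + u)"
proof -
  note D = stable_subspaceD[OF stable_S]
  have "k * t + u \<notin> S n"
  proof
    assume "k * t + u \<in> S n"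
    then have "k * t \<in> S n" using D(6)[OF _ u] by fastforce
    then have "inverse k * (k * t) \<in> S n" using D(3) inverse_F k(1) by blast
    then show False using t k(2) by (simp add: leading_def mult.assoc[symmetric])
  qed
  moreover have "k * t + u \<in> S (Suc n)"
    using t k u S_mono D(2,3) unfolding leading_def by blast
  moreover have "y * (k * t + u) - \<epsilon> * (k * t + u) = k * (y * t - \<epsilon> * t) + (y * u - \<epsilon> * u)"
    using sign_cases[OF \<epsilon>] by (auto simp: distrib_left right_diff_distrib y_mult k(3))
  then have "y * (k * t + u) - \<epsilon> * (k * t + u) \<in> S n"
    using t k u D sign_F[OF \<epsilon>] unfolding leading_def by metis
  ultimately show ?thesis by (simp add: leading_def)
qed

section \<open>Cayley transforms and words in their squares\<close>

definition cayley :: "'a \<Rightarrow> 'a" where "cayley \<epsilon> = (1 + \<epsilon> * y) * T \<epsilon>"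

lemma cayley_eq: "\<epsilon> \<in> signs \<Longrightarrow> cayley \<epsilon> = 2 * T \<epsilon> - 1"
  using T_cancel[of \<epsilon> 1] by (auto simp: cayley_def algebra_simps mult_2)

lemma cayley_inverse:
  assumes "\<epsilon> \<in> signs"
  shows "cayley \<epsilon> * cayley (- \<epsilon>) = 1"
  using linear_nonzero[OF assms] linear_nonzero[OF uminus_sign[OF assms]]
  by (simp add: cayley_def T_def mult.assoc) (simp add: mult.assoc[symmetric])

text \<open>The coefficient condition between opposite signs, where
  \<open>\<epsilon> * \<epsilon>'\<close> is -1.\<close>

definition noncob :: "'a \<Rightarrow> bool" where
  "noncob b \<longleftrightarrow> b \<in> F \<and> (\<forall>f\<in>F. b \<noteq> f + \<sigma> f)"

text \<open>What is left of a reduced word once equal letters are collected and inverse squares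
  cancelled. The rightmost coefficient need only be nonzero, because no factor \<open>T\<close>
  follows it.\<close>

inductive alternating :: "'a \<Rightarrow> 'a \<Rightarrow> bool" where
  base: "\<lbrakk>\<epsilon> \<in> signs; b \<in> F; b \<noteq> 0\<rbrakk> \<Longrightarrow> alternating \<epsilon> (cayley \<epsilon> ^ 2 * b)"
| step: "\<lbrakk>\<epsilon> \<in> signs; alternating (- \<epsilon>) V; noncob b\<rbrakk> \<Longrightarrow> alternating \<epsilon> (cayley \<epsilon> ^ 2 * (b * V))"

lemma two_F: "2 \<in> F"
  using add_F[OF one_F one_F] by simp

lemma two_neq_0: "(2::'a) \<noteq> 0"
  using two_nonzero by simp

lemma cayley_square_mult:
  assumes "\<epsilon> \<in> signs"
  shows "cayley \<epsilon> ^ 2 * a = 4 * (T \<epsilon> * (1 * (T \<epsilon> * a))) + (a - 4 * (T \<epsilon> * a))"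
proof -
  have c: "T \<epsilon> * (2 * a) = 2 * (T \<epsilon> * a)" for a
    by (simp add: mult_2 distrib_left)
  have "cayley \<epsilon> ^ 2 * a = (2 * T \<epsilon> - 1) * ((2 * T \<epsilon> - 1) * a)"
    by (simp add: cayley_eq[OF assms] power2_eq_square mult.assoc)
  also have "\<dots> = 2 * (2 * (T \<epsilon> * (T \<epsilon> * a))) + (a - 2 * (2 * (T \<epsilon> * a)))"
    by (simp add: algebra_simps c mult_2)
  finally show ?thesis by (simp add: mult.assoc[symmetric])
qed

text \<open>The two factors \<open>T \<epsilon>\<close> in the square have equal signs with
  coefficient 1 between them, so \<open>one_not_coboundary\<close> applies; their coefficient 4 is
  nonzero because 2 is.\<close>

lemma leading_cayley:
  assumes \<epsilon>: "\<epsilon> \<in> signs" and a: "a \<in> S n" and lead: "leading n \<epsilon> (T \<epsilon> * a)"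
  shows "leading (Suc n) \<epsilon> (cayley \<epsilon> ^ 2 * a)"
proof -
  note D = stable_subspaceD[OF stable_S]
  have "\<epsilon> * \<epsilon> = 1" using sign_cases[OF \<epsilon>] by auto
  then have *: "leading (Suc n) \<epsilon> (T \<epsilon> * (1 * (T \<epsilon> * a)))"
    by (intro leading_Suc[OF lead \<epsilon> \<epsilon> one_F]) (metis mult_1 one_not_coboundary \<sigma>_def)
  have four: "(4::'a) = 2 * 2" by simp
  have F4: "4 \<in> F" unfolding four by (intro mult_F two_F)
  have "\<sigma> 4 = \<sigma> (1 + 1 + 1 + 1)" by simp
  also have "\<dots> = 4" by (simp only: \<sigma>_add \<sigma>_one) simp
  finally have "\<sigma> 4 = 4" .
  moreover have "(4::'a) \<noteq> 0" unfolding four using two_neq_0 by (simp del: numeral_times_numeral)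
  moreover have "a - 4 * (T \<epsilon> * a) \<in> S (Suc n)"
    using D(6)[OF _ D(3)[OF F4 T_S[OF \<epsilon> a]]] a S_mono by blast
  ultimately show ?thesis
    unfolding cayley_square_mult[OF \<epsilon>] by (intro leading_mod[OF * F4 _ _ _ \<epsilon>])
qed

lemma alternating_leading: "alternating \<epsilon> V \<Longrightarrow> \<exists>n. leading n \<epsilon> V"
proof (induction rule: alternating.induct)
  case (base \<epsilon> b)
  then show ?case
    using leading_cayley[OF base(1) F_S[OF base(2)] leading_0] by blast
next
  case (step \<epsilon> V b)
  then obtain n where n: "leading n (- \<epsilon>) V" by blast
  have b: "b \<in> F" using step by (simp add: noncob_def)
  have "\<epsilon> * - \<epsilon> = -1" using sign_cases[OF step(1)] by auto
  then have "leading (Suc n) \<epsilon> (T \<epsilon> * (b * V))"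
    using step by (intro leading_Suc[OF n _ uminus_sign]) (auto simp: noncob_def)
  moreover have "b * V \<in> S (Suc n)"
    using n b stable_subspaceD(3)[OF stable_S] unfolding leading_def by blast
  ultimately show ?case using leading_cayley[OF step(1)] by blast
qed

text \<open>Otherwise \<open>V\<close> would be \<open>inverse b\<close>, an element of
  \<open>F\<close>, and so would lie in every \<open>S n\<close>.\<close>

lemma mult_alternating_neq_1:
  assumes "alternating \<epsilon> V" "b \<in> F"
  shows "b * V \<noteq> 1"
proof
  assume bV: "b * V = 1"
  then have "b \<noteq> 0" by auto
  then have "V = inverse b" using bV by (metis inverse_unique)
  then have "V \<in> S n" for n using F_S inverse_F assms(2) by blast
  with alternating_leading[OF assms(1)] show False by (auto simp: leading_def)
qed

text \<open>Since 2 is invertible and commutes with \<open>y\<close>, 1 is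
  \<open>inverse 2 + \<sigma> (inverse 2)\<close>.\<close>

lemma noncob_neq_1: "noncob b \<Longrightarrow> b \<noteq> 1"
proof
  assume "noncob b" "b = 1"
  have "\<sigma> 2 = \<sigma> (1 + 1)" by simp
  then have "\<sigma> 2 = 2" by (simp only: \<sigma>_add \<sigma>_one) simp
  then have "y * 2 = 2 * y" using y_mult[of 2 1] by simp
  then have "2 * (y * inverse 2) = (y * 2) * inverse 2" by (simp only: mult.assoc)
  also have "\<dots> = y" by (simp only: mult.assoc right_inverse[OF two_neq_0] mult_1_right)
  finally have "inverse 2 * y = inverse 2 * (2 * (y * inverse 2))" by (simp only:)
  also have "\<dots> = y * inverse 2"
    by (simp only: mult.assoc[symmetric] left_inverse[OF two_neq_0] mult_1_left)
  finally have "\<sigma> (inverse 2) = inverse 2"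
    by (metis \<sigma>_def mult.assoc mult_1_right right_inverse y_nonzero)
  then have "inverse 2 + \<sigma> (inverse 2) = 2 * inverse 2" by (simp only: mult_2)
  then have "inverse 2 + \<sigma> (inverse 2) = 1" by (simp only: right_inverse[OF two_neq_0])
  then show False using \<open>noncob b\<close> \<open>b = 1\<close> inverse_F[OF two_F] by (auto simp: noncob_def)
qed

lemma noncob_in_F: "noncob b \<Longrightarrow> b \<in> F" and noncob_neq_0: "noncob b \<Longrightarrow> b \<noteq> 0"
  using zero_F by (auto simp: noncob_def)

text \<open>The two squares are inverse to each other, so between equal letters of the second
  generator they cancel. A reduced word becomes a product of squares of alternating sign separated
  by nonzero powers of \<open>g0\<close> and \<open>g1\<close>.\<close>

lemma free_pair_cayley:
  assumes g0: "\<And>n. noncob (g0 ^ Suc n)" "\<And>n. noncob (inverse g0 ^ Suc n)"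
    and g1: "\<And>n. noncob (g1 ^ Suc n)" "\<And>n. noncob (inverse g1 ^ Suc n)"
  shows "free_pair g0 (cayley (-1) ^ 2 * g1 * cayley 1 ^ 2)"
proof -
  define D where "D \<epsilon> = cayley \<epsilon> ^ 2" for \<epsilon>
  have "cayley 1 * cayley (-1) = 1" "cayley (-1) * cayley 1 = 1"
    using cayley_inverse[of 1] cayley_inverse[of "-1"] by (simp_all add: signs_def)
  then have D_cancel': "D 1 * D (-1) = 1" "D (-1) * D 1 = 1"
    unfolding D_def power2_eq_square by (metis mult.assoc mult_1_left)+
  then have D_cancel: "D 1 * (D (-1) * a) = a" for a by (simp add: mult.assoc[symmetric])
  have nz: "g0 \<noteq> 0" "g1 \<noteq> 0" "D 1 \<noteq> 0" "D (-1) \<noteq> 0"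
    using noncob_neq_0[OF g0(1)[of 0]] noncob_neq_0[OF g1(1)[of 0]] D_cancel' by auto
  define b where "b = D (-1) * g1 * D 1"
  have inv_D: "inverse (D 1) = D (-1)" "inverse (D (-1)) = D 1"
    using D_cancel' by (simp_all add: inverse_unique)
  have inv_b: "inverse b = D (-1) * inverse g1 * D 1"
    using nz by (simp add: b_def nonzero_inverse_mult_distrib inv_D mult.assoc)
  define h0 h1 where "h0 e = (if e then inverse g0 else g0)" and "h1 e = (if e then inverse g1 else g1)" for e
  have h0: "noncob (h0 e ^ Suc n)" and h1: "noncob (h1 e ^ Suc n)" for e n
    using g0 g1 by (cases e; simp add: h0_def h1_def del: power_Suc)+
  have ev0: "eval_word g0 b ((False, e) # w) = h0 e * eval_word g0 b w" for e w
    by (simp add: h0_def)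
  have ev1: "eval_word g0 b ((True, e) # w) = D (-1) * (h1 e * (D 1 * eval_word g0 b w))" for e w
    using inv_b by (simp add: h1_def b_def mult.assoc)
  have m1: "-1 \<in> signs" and p1: "1 \<in> signs" by (simp_all add: signs_def)
  have alt_step: "alternating \<epsilon> (D \<epsilon> * (c * V))" if "\<epsilon> \<in> signs" "noncob c" "V = 1 \<or> alternating (- \<epsilon>) V" for \<epsilon> c V
    using that noncob_in_F[of c] noncob_neq_0[of c]
      alternating.base[of \<epsilon> c] alternating.step[of \<epsilon> V c] unfolding D_def by auto
  have alt_one: "alternating 1 (D 1)"
    using alternating.base[OF p1 one_F] by (simp add: D_def)
  \<comment> \<open>The first syllable keeps its exponent \<open>Suc n\<close> open, and for the
    second generator the outer \<open>D (-1)\<close> is not absorbed, so that a further equal letter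
    cancels it and only raises the exponent.\<close>
  have main: "(if l then \<exists>n V. eval_word g0 b ((l, e) # w) = D (-1) * (h1 e ^ Suc n * V) \<and> alternating 1 V
    else \<exists>n V. eval_word g0 b ((l, e) # w) = h0 e ^ Suc n * V \<and> (V = 1 \<or> alternating (-1) V))"
    if "reduced_word ((l, e) # w)" for l e w
    using that
  proof (induction w arbitrary: l e)
    case Nil
    show ?case
    proof (cases l)
      case True
      have "eval_word g0 b [(True, e)] = D (-1) * (h1 e ^ Suc 0 * D 1)"
        unfolding ev1 by simp
      then show ?thesis using True alt_one by (metis (full_types))
    next
      case False
      have "eval_word g0 b [(False, e)] = h0 e ^ Suc 0 * 1"
        unfolding ev0 by simp
      then show ?thesis using False by (metis (full_types))
    qed
  next
    case (Cons le w)
    obtain l' e' where le: "le = (l', e')" by (cases le)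
    have red: "reduced_word ((l', e') # w)" "l = l' \<Longrightarrow> e = e'" using Cons.prems le by auto
    note IH = Cons.IH[OF red(1)]
    show ?case
    proof (cases l')
      case True
      then obtain n V where V: "eval_word g0 b ((l', e') # w) = D (-1) * (h1 e' ^ Suc n * V)" "alternating 1 V"
        using IH by auto
      show ?thesis
      proof (cases l)
        case l: True
        have "eval_word g0 b ((True, e) # (l', e') # w) = D (-1) * (h1 e ^ Suc (Suc n) * V)"
          unfolding ev1 V(1) D_cancel using red(2) l True by (simp add: mult.assoc)
        then show ?thesis using V(2) l le by (metis (full_types))
      next
        case l: False
        have "eval_word g0 b ((False, e) # (l', e') # w) = h0 e ^ Suc 0 * (D (-1) * (h1 e' ^ Suc n * V))"
          unfolding ev0 V(1) by simp
        moreover have "alternating (-1) (D (-1) * (h1 e' ^ Suc n * V))"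
          by (rule alt_step[OF m1 h1]) (simp add: V(2))
        ultimately show ?thesis using l le by (metis (full_types))
      qed
    next
      case False
      then obtain n V where V: "eval_word g0 b ((l', e') # w) = h0 e' ^ Suc n * V" "V = 1 \<or> alternating (-1) V"
        using IH by auto
      show ?thesis
      proof (cases l)
        case l: True
        have "eval_word g0 b ((True, e) # (l', e') # w) = D (-1) * (h1 e ^ Suc 0 * (D 1 * (h0 e' ^ Suc n * V)))"
          unfolding ev1 V(1) by simp
        moreover have "alternating 1 (D 1 * (h0 e' ^ Suc n * V))"
          by (rule alt_step[OF p1 h0 V(2)])
        ultimately show ?thesis using l le by (metis (full_types))
      next
        case l: False
        have "eval_word g0 b ((False, e) # (l', e') # w) = h0 e ^ Suc (Suc n) * V"
          unfolding ev0 V(1) using red(2) l False by (simp add: mult.assoc)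
        then show ?thesis using V(2) l le by (metis (full_types))
      qed
    qed
  qed
  have "eval_word g0 b w \<noteq> 1" if w: "reduced_word w" "w \<noteq> []" for w
  proof -
    obtain l e w' where w': "w = (l, e) # w'" using w(2) by (metis neq_Nil_conv surj_pair)
    \<comment> \<open>A word starting with the second generator becomes alternating once
      \<open>D (-1)\<close> is absorbed; any other word is a power of \<open>g0\<close> or its
      inverse, possibly times an alternating product.\<close>
    show ?thesis
    proof (cases l)
      case True
      then obtain n V where V: "eval_word g0 b w = D (-1) * (h1 e ^ Suc n * V)" "alternating 1 V"
        using main[of l e w'] w(1) w' by auto
      have "alternating (-1) (D (-1) * (h1 e ^ Suc n * V))"
        by (rule alt_step[OF m1 h1]) (simp add: V(2))
      then show ?thesis using mult_alternating_neq_1[OF _ one_F] V(1) by force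
    next
      case False
      then obtain n V where V: "eval_word g0 b w = h0 e ^ Suc n * V" "V = 1 \<or> alternating (-1) V"
        using main[of l e w'] w(1) w' by auto
      then show ?thesis
        using mult_alternating_neq_1[OF _ noncob_in_F[OF h0[of e n]]] noncob_neq_1[OF h0[of e n]] by auto
    qed
  qed
  then have "free_pair g0 b" using nz by (simp add: free_pair_def b_def)
  then show ?thesis by (simp add: b_def D_def)
qed

end

section \<open>Evaluation of polynomials in a division ring\<close>

definition ring_map :: "('r::comm_ring_1 \<Rightarrow> 'a::division_ring) \<Rightarrow> bool" where
  "ring_map \<phi> \<longleftrightarrow> \<phi> 1 = 1 \<and> (\<forall>a b. \<phi> (a + b) = \<phi> a + \<phi> b) \<and> (\<forall>a b. \<phi> (a * b) = \<phi> a * \<phi> b)"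

text \<open>Coefficients come from a commutative ring and stand to the left of the powers of
  \<open>r\<close>; multiplicativity is shown for points \<open>r\<close> that commute with the
  image of \<open>\<phi>\<close>.\<close>

definition ev :: "('r::comm_ring_1 \<Rightarrow> 'a::division_ring) \<Rightarrow> 'a \<Rightarrow> 'r poly \<Rightarrow> 'a" where
  "ev \<phi> r p = (\<Sum>i\<le>degree p. \<phi> (coeff p i) * r ^ i)"

context
  fixes \<phi> :: "'r::comm_ring_1 \<Rightarrow> 'a::division_ring"
  assumes \<phi>: "ring_map \<phi>"
begin

lemma ring_map_simps [simp]:
  "\<phi> 1 = 1" "\<phi> (a + b) = \<phi> a + \<phi> b" "\<phi> (a * b) = \<phi> a * \<phi> b"
  "\<phi> 0 = 0" "\<phi> (- a) = - \<phi> a" "\<phi> (a - b) = \<phi> a - \<phi> b"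
proof -
  show *: "\<phi> 1 = 1" "\<phi> (a + b) = \<phi> a + \<phi> b" "\<phi> (a * b) = \<phi> a * \<phi> b" for a b
    using \<phi> by (auto simp: ring_map_def)
  show 0: "\<phi> 0 = 0" using *(2)[of 0 0] by simp
  show m: "\<phi> (- a) = - \<phi> a" for a using *(2)[of a "- a"] 0 by (simp add: eq_neg_iff_add_eq_0 add.commute)
  show "\<phi> (a - b) = \<phi> a - \<phi> b" using *(2)[of a "- b"] m by simp
qed

lemma ring_map_power: "\<phi> (a ^ n) = \<phi> a ^ n"
  by (induction n) simp_all

lemma ring_map_commute: "\<phi> a * \<phi> b = \<phi> b * \<phi> a"
  by (metis mult.commute ring_map_simps(3))

lemma ev_bound: "degree p \<le> n \<Longrightarrow> ev \<phi> r p = (\<Sum>i\<le>n. \<phi> (coeff p i) * r ^ i)"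
  unfolding ev_def by (intro sum.mono_neutral_left) (auto simp: coeff_eq_0)

lemma ev_0 [simp]: "ev \<phi> r 0 = 0"
  by (simp add: ev_def)

lemma ev_pCons [simp]: "ev \<phi> r (pCons a p) = \<phi> a + ev \<phi> r p * r"
proof -
  have "ev \<phi> r (pCons a p) = (\<Sum>i\<le>Suc (degree p). \<phi> (coeff (pCons a p) i) * r ^ i)"
    by (rule ev_bound) (simp add: degree_pCons_le)
  also have "\<dots> = \<phi> a + (\<Sum>i\<le>degree p. \<phi> (coeff p i) * r ^ Suc i)"
    by (subst sum.atMost_Suc_shift) simp
  also have "(\<Sum>i\<le>degree p. \<phi> (coeff p i) * r ^ Suc i) = ev \<phi> r p * r"
    unfolding ev_def sum_distrib_right power_Suc2 by (simp add: mult.assoc)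
  finally show ?thesis .
qed

lemma ev_1 [simp]: "ev \<phi> r 1 = 1"
  using ev_pCons[of r 1 0] by (simp add: one_pCons)

lemma ev_add: "ev \<phi> r (p + q) = ev \<phi> r p + ev \<phi> r q"
proof (induction p arbitrary: q)
  case (pCons a p)
  then show ?case by (cases q) (simp add: distrib_right add_ac)
qed simp

lemma ev_smult: "ev \<phi> r (smult c p) = \<phi> c * ev \<phi> r p"
  by (induction p) (simp_all add: distrib_left mult.assoc)

lemma ev_commute:
  assumes "\<And>a. u * \<phi> a = \<phi> a * u" "u * r = r * u"
  shows "u * ev \<phi> r p = ev \<phi> r p * u"
proof (induction p)
  case (pCons a p)
  have "u * (ev \<phi> r p * r) = ev \<phi> r p * r * u"
    by (metis pCons.IH assms(2) mult.assoc)
  then show ?case by (simp add: distrib_left distrib_right assms)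
qed simp

lemma ev_at_image: "ev \<phi> (\<phi> a) p = \<phi> (poly p a)"
  by (induction p) (simp_all add: ring_map_commute)

context
  fixes r :: 'a
  assumes r: "\<And>a. r * \<phi> a = \<phi> a * r"
begin

lemma ev_mult: "ev \<phi> r (p * q) = ev \<phi> r p * ev \<phi> r q"
proof (induction p)
  case (pCons a p)
  have "ev \<phi> r p * r * ev \<phi> r q = ev \<phi> r p * ev \<phi> r q * r"
    by (metis ev_commute[OF r refl] mult.assoc)
  then show ?case
    by (simp only: mult_pCons_left ev_pCons ev_add ev_smult distrib_right pCons.IH)
      (simp add: mult.assoc)
qed simp

lemma ring_map_ev: "ring_map (ev \<phi> r)"
  by (simp add: ring_map_def ev_add ev_mult)

lemma ev_scale: "ev \<phi> r (pcompose p [:0, a:]) = ev \<phi> (\<phi> a * r) p"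
proof (induction p)
  case (pCons b p)
  have "(\<phi> a * r) * ev \<phi> (\<phi> a * r) p = ev \<phi> (\<phi> a * r) p * (\<phi> a * r)"
    by (rule ev_commute[OF _ refl]) (metis r mult.assoc ring_map_commute)
  then show ?case
    by (simp only: pcompose_pCons ev_add ev_mult ev_pCons ev_0 pCons.IH mult_zero_left
        ring_map_simps add_0 add_0_right)
qed simp

end

end

lemma commute_inverse:
  fixes u c :: "'a::division_ring"
  assumes "u * c = c * u" "c \<noteq> 0"
  shows "u * inverse c = inverse c * u"
  using assms by (metis mult.assoc left_inverse mult_1_left mult_1_right right_inverse)

text \<open>Moving \<open>c\<close> past \<open>w ^ i\<close> produces \<open>\<zeta> ^ i\<close>,
  and these eigenvalues are distinct. Subtracting a multiple of the relation from its conjugate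
  removes the top term. It serves for the powers of \<open>x\<close>, with \<open>c\<close> equal to
  \<open>y\<close>, and the other way round.\<close>

lemma powers_independent_eigen:
  fixes c w \<zeta> :: "'a::division_ring"
  assumes w: "c * w = \<zeta> * w * c" "w \<noteq> 0" and c: "c \<noteq> 0" "\<zeta> * c = c * \<zeta>" and \<zeta>: "\<zeta> * w = w * \<zeta>"
    and inf: "\<And>n. 0 < n \<Longrightarrow> \<zeta> ^ n \<noteq> 1"
    and f: "\<And>i. c * f i = f i * c" "\<And>i. \<zeta> * f i = f i * \<zeta>"
    and sum: "(\<Sum>i\<le>n. f i * w ^ i) = 0" and i: "i \<le> n"
  shows "f i = 0"
  using f sum i
proof (induction n arbitrary: f i)
  case (Suc n)
  have \<zeta>_w: "\<zeta> ^ k * w = w * \<zeta> ^ k" for k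
    using \<zeta> by (metis power_commuting_commutes)
  have c_\<zeta>: "c * \<zeta> ^ k = \<zeta> ^ k * c" for k
    using c(2) by (metis power_commuting_commutes)
  have f_\<zeta>: "\<zeta> ^ k * f j = f j * \<zeta> ^ k" for k j
    using Suc.prems(2) by (metis power_commuting_commutes)
  have "\<zeta> \<noteq> 0" using w c by auto
  have cw: "c * w ^ k = \<zeta> ^ k * w ^ k * c" for k
  proof (induction k)
    case (Suc k)
    have "c * w ^ Suc k = \<zeta> * w * (c * w ^ k)" by (simp add: w(1) mult.assoc[symmetric])
    also have "\<dots> = \<zeta> * (w * \<zeta> ^ k) * w ^ k * c" by (simp add: Suc mult.assoc)
    finally show ?case by (simp add: \<zeta>_w[symmetric] mult.assoc)
  qed simp
  have "0 = c * (\<Sum>i\<le>Suc n. f i * w ^ i)" by (simp only: Suc.prems(3) mult_zero_right)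
  also have "\<dots> = (\<Sum>i\<le>Suc n. f i * \<zeta> ^ i * w ^ i) * c"
    unfolding sum_distrib_left sum_distrib_right
  proof (rule sum.cong)
    show "c * (f i * w ^ i) = f i * \<zeta> ^ i * w ^ i * c" for i
      by (metis Suc.prems(1) cw mult.assoc)
  qed simp
  finally have 1: "(\<Sum>i\<le>Suc n. f i * \<zeta> ^ i * w ^ i) = 0" using c(1) by simp
  have "0 = \<zeta> ^ Suc n * (\<Sum>i\<le>Suc n. f i * w ^ i)" by (simp only: Suc.prems(3) mult_zero_right)
  also have "\<dots> = (\<Sum>i\<le>Suc n. f i * \<zeta> ^ Suc n * w ^ i)"
    unfolding sum_distrib_left by (simp only: mult.assoc[symmetric] f_\<zeta>)
  finally have "(\<Sum>i\<le>Suc n. f i * (\<zeta> ^ i - \<zeta> ^ Suc n) * w ^ i) = 0"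
    using 1 by (simp only: right_diff_distrib left_diff_distrib sum_subtractf) simp
  then have 2: "(\<Sum>i\<le>n. f i * (\<zeta> ^ i - \<zeta> ^ Suc n) * w ^ i) = 0"
    by (simp only: sum.atMost_Suc diff_self mult_zero_right mult_zero_left add_0_right)
  have low: "f i = 0" if "i \<le> n" for i
  proof -
    have "f i * (\<zeta> ^ i - \<zeta> ^ Suc n) = 0"
    proof (rule Suc.IH[OF _ _ 2 that])
      show "c * (f i * (\<zeta> ^ i - \<zeta> ^ Suc n)) = f i * (\<zeta> ^ i - \<zeta> ^ Suc n) * c" for i
      proof -
        have "c * (\<zeta> ^ i - \<zeta> ^ Suc n) = (\<zeta> ^ i - \<zeta> ^ Suc n) * c"
          by (simp only: right_diff_distrib left_diff_distrib c_\<zeta>)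
        then show ?thesis by (metis Suc.prems(1) mult.assoc)
      qed
      show "\<zeta> * (f i * (\<zeta> ^ i - \<zeta> ^ Suc n)) = f i * (\<zeta> ^ i - \<zeta> ^ Suc n) * \<zeta>" for i
      proof -
        have "\<zeta> * (\<zeta> ^ i - \<zeta> ^ Suc n) = (\<zeta> ^ i - \<zeta> ^ Suc n) * \<zeta>"
          by (simp only: right_diff_distrib left_diff_distrib power_commutes)
        then show ?thesis by (metis Suc.prems(2) mult.assoc)
      qed
    qed
    moreover have "\<zeta> ^ i \<noteq> \<zeta> ^ Suc n"
    proof
      assume "\<zeta> ^ i = \<zeta> ^ Suc n"
      moreover have "\<zeta> ^ i * \<zeta> ^ (Suc n - i) = \<zeta> ^ Suc n"
        using that by (subst power_add[symmetric]) (simp del: power_Suc)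
      ultimately have "\<zeta> ^ i * 1 = \<zeta> ^ i * \<zeta> ^ (Suc n - i)" by simp
      then show False using inf[of "Suc n - i"] that \<open>\<zeta> \<noteq> 0\<close>
        by (metis mult_left_cancel power_not_zero less_Suc_eq_le zero_less_diff)
    qed
    ultimately show ?thesis by simp
  qed
  then have "(\<Sum>i\<le>n. f i * w ^ i) = 0" by simp
  then have "f (Suc n) * w ^ Suc n = 0"
    using Suc.prems(3) by (simp only: sum.atMost_Suc add_0_left)
  then have "f (Suc n) = 0" using w(2) by (metis mult_eq_0_iff power_not_zero)
  then show ?case using low Suc.prems(4) by (auto simp: le_Suc_eq)
qed simp

section \<open>Rational functions on a quantum plane\<close>

locale quantum_plane =
  fixes x y z :: "'a::division_ring"
  assumes yx: "y * x = z * x * y" and zx: "z * x = x * z" and zy: "z * y = y * z"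
    and x_nonzero: "x \<noteq> 0" and y_nonzero': "y \<noteq> 0"
    and z_order: "\<And>n. 0 < n \<Longrightarrow> z ^ n \<noteq> 1"
    and two_nonzero': "(1::'a) + 1 \<noteq> 0"
begin

text \<open>The inner variable goes to \<open>z\<close> and the outer one to its inverse, so that
  scaling \<open>x\<close> by \<open>z\<close> or by \<open>inverse z\<close> can be carried out on
  polynomials.\<close>

definition \<phi> :: "int poly poly \<Rightarrow> 'a" where "\<phi> = ev (ev of_int z) (inverse z)"

definition E :: "'a \<Rightarrow> int poly poly poly \<Rightarrow> 'a" where "E = ev \<phi>"

text \<open>Polynomials only name the elements: \<open>\<phi>\<close> may have a kernel, so
  nonvanishing is asked of \<open>E x Q\<close> and not of \<open>Q\<close>.\<close>

definition F :: "'a set" where "F = {f. \<exists>P Q. E x Q \<noteq> 0 \<and> f * E x Q = E x P}"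

text \<open>For \<open>f = P(x)/Q(x)\<close> with \<open>Q(r) \<noteq> 0\<close>, \<open>val r f v\<close> says that \<open>f\<close> is regular
  at the point \<open>x = r\<close>, with value \<open>v\<close>.\<close>

definition val :: "'a \<Rightarrow> 'a \<Rightarrow> 'a \<Rightarrow> bool" where
  "val r f v \<longleftrightarrow> (\<exists>P Q. E r Q \<noteq> 0 \<and> f * E x Q = E x P \<and> v * E r Q = E r P)"

lemma z_nonzero: "z \<noteq> 0"
  using yx x_nonzero y_nonzero' by auto

lemma commute_inverse_z: "u * z = z * u \<Longrightarrow> u * inverse z = inverse z * u"
  by (rule commute_inverse[OF _ z_nonzero])

lemma ring_map_of_int: "ring_map (of_int :: int \<Rightarrow> 'a)"
  by (simp add: ring_map_def)

lemma of_int_commute: "u * of_int n = of_int n * (u::'a)"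
  by (metis mult_of_int_commute)

lemma ring_map_z: "ring_map (ev (of_int :: int \<Rightarrow> 'a) z)"
  by (rule ring_map_ev[OF ring_map_of_int of_int_commute])

lemma ev_z_commute: "u * z = z * u \<Longrightarrow> u * ev of_int z p = ev of_int z p * u"
  by (rule ev_commute[OF ring_map_of_int of_int_commute])

lemma ring_map_\<phi>: "ring_map \<phi>"
  unfolding \<phi>_def
  by (rule ring_map_ev[OF ring_map_z ev_z_commute]) (simp add: commute_inverse_z)

lemma \<phi>_commute: "u * z = z * u \<Longrightarrow> u * \<phi> a = \<phi> a * u"
  unfolding \<phi>_def by (rule ev_commute[OF ring_map_z ev_z_commute]) (simp_all add: commute_inverse_z)

definition t where "t = ([:[:0, 1:]:] :: int poly poly)"
definition t_inv where "t_inv = ([:0, 1:] :: int poly poly)"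

lemma \<phi>_t: "\<phi> t = z" and \<phi>_t_inv: "\<phi> t_inv = inverse z"
  by (simp_all add: t_def t_inv_def \<phi>_def ev_pCons[OF ring_map_z] ev_0[OF ring_map_z]
      ev_pCons[OF ring_map_of_int] ev_0[OF ring_map_of_int] ring_map_simps[OF ring_map_z] ev_1[OF ring_map_z]
      flip: one_pCons)

text \<open>At these points \<open>E r\<close> is multiplicative, since they centralise the image of
  \<open>\<phi>\<close>.\<close>

definition commuting :: "'a set" where "commuting = {r. r * z = z * r}"

lemma commuting_simps [simp]: "0 \<in> commuting" "1 \<in> commuting" "x \<in> commuting" "z \<in> commuting"
  "z powi j \<in> commuting"
  using zx by (auto simp: commuting_def) (metis power_int_commutes)

lemma commuting_\<phi>: "r \<in> commuting \<Longrightarrow> r * \<phi> a = \<phi> a * r"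
  by (simp add: commuting_def \<phi>_commute)

lemma commuting_mult_z [simp]: "r \<in> commuting \<Longrightarrow> z * r \<in> commuting"
  "r \<in> commuting \<Longrightarrow> inverse z * r \<in> commuting"
  using z_nonzero by (auto simp: commuting_def mult.assoc)
    (metis left_inverse mult.assoc mult_1_left right_inverse)

lemmas \<phi>_simps = ring_map_simps[OF ring_map_\<phi>] \<phi>_t \<phi>_t_inv

lemma E_simps [simp]:
  "E r 0 = 0" "E r 1 = 1" "E r (p + q) = E r p + E r q" "E r (- p) = - E r p" "E r (p - q) = E r p - E r q"
  "E r (pCons a p) = \<phi> a + E r p * r"
  and E_mult: "r \<in> commuting \<Longrightarrow> E r (p * q) = E r p * E r q"
proof -
  show "E r 0 = 0" "E r 1 = 1" "E r (p + q) = E r p + E r q"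
    "E r (pCons a p) = \<phi> a + E r p * r" for p q
    by (simp_all add: E_def ev_add ring_map_\<phi>)
  note * = this
  show m: "E r (- p) = - E r p" for p using *(3)[of p "-p"] *(1) by (simp add: eq_neg_iff_add_eq_0 add.commute)
  show "E r (p - q) = E r p - E r q" using *(3)[of p "-q"] m by simp
  show "E r (p * q) = E r p * E r q" if "r \<in> commuting"
    unfolding E_def by (rule ev_mult[OF ring_map_\<phi> commuting_\<phi>[OF that]])
qed

lemma E_commute: "r \<in> commuting \<Longrightarrow> E r p * E r q = E r q * E r p"
  by (metis E_mult mult.commute)

lemma E_scale:
  "r \<in> commuting \<Longrightarrow> E r (pcompose p [:0, t:]) = E (z * r) p"
  "r \<in> commuting \<Longrightarrow> E r (pcompose p [:0, t_inv:]) = E (inverse z * r) p"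
  unfolding E_def by (simp_all only: ev_scale[OF ring_map_\<phi> commuting_\<phi>] \<phi>_t \<phi>_t_inv)

text \<open>Conjugation by \<open>y\<close> fixes \<open>z\<close>, hence all coefficients, and
  moves only the point.\<close>

lemma E_conj: "y * E r p = E (y * r * inverse y) p * y"
proof (induction p)
  case (pCons a p)
  have "y * (E r p * r) = E (y * r * inverse y) p * (y * r * inverse y) * y"
    using pCons y_nonzero' by (simp add: mult.assoc) (simp add: mult.assoc[symmetric])
  moreover have "y * \<phi> a = \<phi> a * y" by (rule \<phi>_commute[OF zy[symmetric]])
  ultimately show ?case by (simp add: distrib_left distrib_right)
qed simp

lemma y_E: "y * E x p = E (z * x) p * y"
  using E_conj[of x p] yx y_nonzero' by (simp add: mult.assoc)

lemma E_zx: "E (z * x) p = y * E x p * inverse y"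
  using y_E[of p] y_nonzero' by (simp add: mult.assoc)

text \<open>Conjugation by \<open>y\<close> separates the powers of \<open>x\<close>, so
  \<open>\<phi>\<close> kills every coefficient of \<open>P\<close>. Polynomial identities at
  \<open>x\<close> therefore specialise to every point.\<close>

lemma E_x_eq_0:
  assumes "E x P = 0"
  shows "E r P = 0"
proof -
  have "\<phi> (coeff P i) = 0" for i
  proof (cases "i \<le> degree P")
    case True
    show ?thesis
    proof (rule powers_independent_eigen[OF yx x_nonzero y_nonzero' zy zx z_order _ _ _ True])
      show "(\<Sum>i\<le>degree P. \<phi> (coeff P i) * x ^ i) = 0"
        using assms by (simp add: E_def ev_def)
    qed (use \<phi>_commute zy in auto)
  qed (simp add: coeff_eq_0 \<phi>_simps)
  then show ?thesis by (simp add: E_def ev_def)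
qed

text \<open>Cross-multiplying the two presentations gives an identity at \<open>x\<close>, which
  \<open>E_x_eq_0\<close> transfers to \<open>r\<close>.\<close>

lemma val_unique:
  assumes "val r f v" "val r f v'" "r \<in> commuting"
  shows "v = v'"
proof -
  obtain P Q P' Q' where
    Q: "E r Q \<noteq> 0" "f * E x Q = E x P" "v * E r Q = E r P" and
    Q': "E r Q' \<noteq> 0" "f * E x Q' = E x P'" "v' * E r Q' = E r P'"
    using assms unfolding val_def by blast
  have x: "x \<in> commuting" by simp
  have "E x P * E x Q' = E x P' * E x Q"
    by (metis Q(2) Q'(2) E_commute[OF x] mult.assoc)
  then have "E x (P * Q' - P' * Q) = 0" by (simp add: E_mult)
  then have "E r (P * Q' - P' * Q) = 0" by (rule E_x_eq_0)
  then have "E r P * E r Q' = E r P' * E r Q" using assms(3) by (simp add: E_mult)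
  then have "v * (E r Q * E r Q') = v' * (E r Q * E r Q')"
    by (metis Q(3) Q'(3) E_commute[OF assms(3)] mult.assoc)
  then show ?thesis using Q(1) Q'(1) by simp
qed

lemma fraction_add:
  assumes "f * q = p" "g * q' = p'" "q * q' = q' * (q::'a)"
  shows "(f + g) * (q * q') = p * q' + p' * q"
  using assms by (metis distrib_right mult.assoc)

lemma fraction_mult:
  assumes "f * q = p" "g * q' = p'" "q * q' = q' * q" "p' * q = q * (p'::'a)"
  shows "(f * g) * (q * q') = p * p'"
  using assms by (metis mult.assoc)

lemma val_add:
  assumes "val r f v" "val r g w" "r \<in> commuting"
  shows "val r (f + g) (v + w)"
proof -
  obtain P Q P' Q' where
    Q: "E r Q \<noteq> 0" "f * E x Q = E x P" "v * E r Q = E r P" and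
    Q': "E r Q' \<noteq> 0" "g * E x Q' = E x P'" "w * E r Q' = E r P'"
    using assms unfolding val_def by blast
  show ?thesis unfolding val_def
    using fraction_add[OF Q(2) Q'(2) E_commute] fraction_add[OF Q(3) Q'(3) E_commute[OF assms(3)]] Q(1) Q'(1)
    by (intro exI[of _ "P * Q' + P' * Q"] exI[of _ "Q * Q'"]) (simp add: E_mult assms(3))
qed

lemma val_mult:
  assumes "val r f v" "val r g w" "r \<in> commuting"
  shows "val r (f * g) (v * w)"
proof -
  obtain P Q P' Q' where
    Q: "E r Q \<noteq> 0" "f * E x Q = E x P" "v * E r Q = E r P" and
    Q': "E r Q' \<noteq> 0" "g * E x Q' = E x P'" "w * E r Q' = E r P'"
    using assms unfolding val_def by blast
  show ?thesis unfolding val_def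
    using fraction_mult[OF Q(2) Q'(2) E_commute E_commute]
      fraction_mult[OF Q(3) Q'(3) E_commute[OF assms(3)] E_commute[OF assms(3)]] Q(1) Q'(1)
    by (intro exI[of _ "P * P'"] exI[of _ "Q * Q'"]) (simp add: E_mult assms(3))
qed

lemma val_E: "val r (E x P) (E r P)"
  unfolding val_def by (intro exI[of _ P] exI[of _ 1]) simp

lemma val_uminus: "val r f v \<Longrightarrow> val r (- f) (- v)"
  unfolding val_def by (elim exE, rule_tac x = "- P" in exI, rule_tac x = Q in exI) simp

lemma val_F: "val r f v \<Longrightarrow> f \<in> F"
  unfolding val_def F_def using E_x_eq_0 by blast

lemma E_F: "E x P \<in> F"
  using val_E val_F by blast

lemma F_I: "\<lbrakk>E x Q \<noteq> 0; f * E x Q = E x P\<rbrakk> \<Longrightarrow> f \<in> F"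
  unfolding F_def by blast

lemma F_commute:
  assumes "f \<in> F" "g \<in> F"
  shows "f * g = g * f"
proof -
  obtain P Q P' Q' where *: "E x Q \<noteq> 0" "f * E x Q = E x P" "E x Q' \<noteq> 0" "g * E x Q' = E x P'"
    using assms unfolding F_def by blast
  have "(f * g) * (E x Q * E x Q') = E x P * E x P'" "(g * f) * (E x Q' * E x Q) = E x P' * E x P"
    using * by (auto intro!: fraction_mult E_commute)
  moreover have "E x Q' * E x Q = E x Q * E x Q'" "E x P' * E x P = E x P * E x P'"
    by (simp_all add: E_commute)
  ultimately have "(f * g) * (E x Q * E x Q') = (g * f) * (E x Q * E x Q')"
    by (simp only:)
  then show ?thesis using *(1,3) by simp
qed

lemma F_val_x: "f \<in> F \<longleftrightarrow> val x f f"
  unfolding F_def val_def by auto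

lemma F_add: "\<lbrakk>f \<in> F; g \<in> F\<rbrakk> \<Longrightarrow> f + g \<in> F"
  and F_mult: "\<lbrakk>f \<in> F; g \<in> F\<rbrakk> \<Longrightarrow> f * g \<in> F"
  and F_uminus: "f \<in> F \<Longrightarrow> - f \<in> F"
  using val_add[of x] val_mult[of x] val_uminus[of x] by (auto simp: F_val_x)

lemma F_one: "1 \<in> F" and F_zero: "0 \<in> F" and F_x: "x \<in> F" and F_z: "z \<in> F"
  using E_F[of 1] E_F[of 0] E_F[of "[:0, 1:]"] E_F[of "[:t:]"]
  by (simp_all add: \<phi>_simps)

lemma F_inverse:
  assumes "f \<in> F"
  shows "inverse f \<in> F"
proof (cases "f = 0")
  case False
  obtain P Q where *: "E x Q \<noteq> 0" "f * E x Q = E x P"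
    using assms unfolding F_def by blast
  have "inverse f * E x P = E x Q"
    using False by (simp add: *(2)[symmetric]) (simp add: mult.assoc[symmetric])
  moreover have "E x P \<noteq> 0" using * False by (metis mult_eq_0_iff)
  ultimately show ?thesis by (rule F_I[rotated])
qed (use F_zero in simp)

lemma F_power: "f \<in> F \<Longrightarrow> f ^ n \<in> F"
  by (induction n) (auto simp: F_one F_mult)

text \<open>Conjugation by \<open>y\<close> substitutes \<open>z * x\<close> for \<open>x\<close> in
  numerator and denominator.\<close>

lemma val_conj:
  assumes "val (z * r) f v" "r \<in> commuting"
  shows "val r (y * f * inverse y) v"
proof -
  obtain P Q where
    Q: "E (z * r) Q \<noteq> 0" "f * E x Q = E x P" "v * E (z * r) Q = E (z * r) P"
    using assms unfolding val_def by blast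
  have "y * f * inverse y * E (z * x) Q = y * (f * E x Q) * inverse y"
    using y_nonzero' by (simp add: E_zx mult.assoc) (simp add: mult.assoc[symmetric])
  also have "\<dots> = E (z * x) P"
    by (simp only: Q(2) E_zx)
  finally show ?thesis unfolding val_def
    using Q assms(2)
    by (intro exI[of _ "pcompose P [:0, t:]"] exI[of _ "pcompose Q [:0, t:]"]) (simp add: E_scale)
qed

text \<open>The opposite substitution, \<open>inverse z * x\<close> for \<open>x\<close>, is the
  reason for having \<open>t_inv\<close> among the coefficients.\<close>

lemma val_conj_inverse:
  assumes "val r (y * f * inverse y) v" "r \<in> commuting"
  shows "val (z * r) f v"
proof -
  obtain P Q where
    Q: "E r Q \<noteq> 0" "y * f * inverse y * E x Q = E x P" "v * E r Q = E r P"
    using assms unfolding val_def by blast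
  let ?x = "inverse z * x"
  have x: "z * ?x = x"
    using z_nonzero by (simp add: mult.assoc[symmetric])
  have *: "y * E ?x p = E x p * y" for p
  proof -
    have "y * ?x = inverse z * (y * x)"
      by (simp only: mult.assoc[symmetric] commute_inverse_z[OF zy[symmetric]])
    also have "\<dots> = x * y"
      using z_nonzero by (simp only: yx mult.assoc[symmetric]) simp
    finally have "y * ?x * inverse y = x"
      using y_nonzero' by (simp add: mult.assoc)
    then show ?thesis using E_conj[of ?x p] by simp
  qed
  have "y * (f * E ?x Q) = y * E ?x P"
  proof -
    have "y * (f * E ?x Q) = y * f * inverse y * (y * E ?x Q)"
      using y_nonzero' by (simp add: mult.assoc) (simp add: mult.assoc[symmetric])
    also have "\<dots> = y * f * inverse y * E x Q * y" by (simp only: * mult.assoc)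
    finally show ?thesis by (simp only: Q(2) *)
  qed
  then have "f * E ?x Q = E ?x P" using y_nonzero' by simp
  moreover have "inverse z * (z * r) = r" using z_nonzero by (simp add: mult.assoc[symmetric])
  ultimately show ?thesis unfolding val_def
    using Q assms(2)
    by (intro exI[of _ "pcompose P [:0, t_inv:]"] exI[of _ "pcompose Q [:0, t_inv:]"]) (simp add: E_scale)
qed

lemma F_conj: "f \<in> F \<Longrightarrow> y * f * inverse y \<in> F"
proof -
  assume "f \<in> F"
  then obtain P Q where *: "E x Q \<noteq> 0" "f * E x Q = E x P" unfolding F_def by blast
  have "E (z * x) Q \<noteq> 0" using y_E[of Q] *(1) y_nonzero' by (metis mult_eq_0_iff)
  then have "val (z * x) f (E (z * x) P * inverse (E (z * x) Q))"
    using * unfolding val_def by (intro exI[of _ P] exI[of _ Q]) (simp add: mult.assoc)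
  then show ?thesis using val_conj val_F by (metis commuting_simps(3))
qed


section \<open>Poles along the orbit of 1 under multiplication by \<open>z\<close>\<close>

lemma z_powi_eq_1: "z powi i = 1 \<longleftrightarrow> i = 0"
proof
  assume i: "z powi i = 1"
  show "i = 0"
  proof (rule ccontr)
    assume "i \<noteq> 0"
    have "z powi \<bar>i\<bar> = 1" using i by (cases "0 \<le> i") (simp_all add: power_int_minus)
    moreover have "z powi \<bar>i\<bar> = z ^ nat \<bar>i\<bar>" by (simp add: power_int_def)
    ultimately show False using z_order[of "nat \<bar>i\<bar>"] \<open>i \<noteq> 0\<close> by simp
  qed
qed simp

lemma z_powi_inj: "z powi i = z powi j \<Longrightarrow> i = j"
proof -
  assume "z powi i = z powi j"
  moreover have "z powi i = z powi (i - j) * z powi j"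
    using z_nonzero by (simp flip: power_int_add)
  ultimately have "z powi (i - j) = 1" using z_nonzero by simp
  then show "i = j" by (simp add: z_powi_eq_1)
qed

lemma z_powi_image: "\<exists>a. \<phi> a = z powi i"
proof (cases "0 \<le> i")
  case True
  then have "\<phi> (t ^ nat i) = z powi i"
    by (simp add: ring_map_power[OF ring_map_\<phi>] \<phi>_simps power_int_def)
  then show ?thesis by blast
next
  case False
  then have "\<phi> (t_inv ^ nat (- i)) = z powi i"
    by (simp add: ring_map_power[OF ring_map_\<phi>] \<phi>_simps power_int_def)
  then show ?thesis by blast
qed

text \<open>A root in the orbit is the image of some coefficient \<open>a\<close>. Synthetic
  division at \<open>a\<close> lowers the degree and, the powers of \<open>z\<close> being distinct,
  costs only one index.\<close>

lemma finite_roots: "E x Q \<noteq> 0 \<Longrightarrow> finite {i. E (z powi i) Q = 0}"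
proof (induction "degree Q" arbitrary: Q rule: less_induct)
  case less
  show ?case
  proof (cases "\<exists>i. E (z powi i) Q = 0")
    case True
    then obtain i a where i: "E (z powi i) Q = 0" and a: "\<phi> a = z powi i"
      using z_powi_image by blast
    \<comment> \<open>The remainder \<open>poly Q a\<close> itself may be nonzero; only its image is
      known to vanish.\<close>
    have root: "\<phi> (poly Q a) = 0"
      using i ev_at_image[OF ring_map_\<phi>, of a Q] by (simp add: E_def a)
    define R where "R = synthetic_div Q a"
    have Q: "E r Q = (r - z powi i) * E r R" if "r \<in> commuting" for r
    proof -
      have "E r Q = E r ([:-a, 1:] * R + [:poly Q a:])"
        unfolding R_def synthetic_div_correct' ..
      also have "\<dots> = E r [:-a, 1:] * E r R + E r [:poly Q a:]"
        by (simp only: E_mult[OF that] E_simps(3))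
      finally show ?thesis by (simp add: root \<phi>_simps a)
    qed
    have R: "E x R \<noteq> 0" using Q[of x] less.prems by auto
    have "degree Q \<noteq> 0"
    proof
      assume "degree Q = 0"
      then have "R = 0" by (simp add: R_def synthetic_div_eq_0_iff)
      then show False using R by simp
    qed
    then have "finite {i. E (z powi i) R = 0}"
      using less.hyps[OF _ R] by (simp add: R_def degree_synthetic_div)
    moreover have "{j. E (z powi j) Q = 0} \<subseteq> insert i {i. E (z powi i) R = 0}"
      using Q z_powi_inj by auto
    ultimately show ?thesis by (meson finite.insertI finite_subset)
  qed simp
qed

definition regular :: "int \<Rightarrow> 'a \<Rightarrow> bool" where
  "regular i f \<longleftrightarrow> (\<exists>v. val (z powi i) f v)"

lemma regular_diff: "\<lbrakk>regular i f; regular i g\<rbrakk> \<Longrightarrow> regular i (f - g)"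
  unfolding regular_def using val_add val_uminus by (metis add_uminus_conv_diff commuting_simps(5))

lemma regular_add: "\<lbrakk>regular i f; regular i g\<rbrakk> \<Longrightarrow> regular i (f + g)"
  unfolding regular_def using val_add commuting_simps(5) by blast

lemma regular_power: "regular i f \<Longrightarrow> regular i (f ^ n)"
  unfolding regular_def
proof (induction n)
  case 0
  then show ?case using val_E[of _ 1] by auto
next
  case (Suc n)
  then obtain v w where "val (z powi i) f v" "val (z powi i) (f ^ n) w" by blast
  then show ?case using val_mult[of "z powi i" f v "f ^ n" w] by auto
qed

lemma regular_conj: "regular i (y * f * inverse y) \<longleftrightarrow> regular (i + 1) f"
proof -
  have "z powi (i + 1) = z * z powi i" using z_nonzero by (simp add: power_int_add_1')
  then show ?thesis
    unfolding regular_def using val_conj[of "z powi i" f] val_conj_inverse[of "z powi i" f] by auto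
qed

lemma finite_poles:
  assumes "f \<in> F"
  shows "finite {i. \<not> regular i f}"
proof -
  obtain P Q where *: "E x Q \<noteq> 0" "f * E x Q = E x P" using assms unfolding F_def by blast
  have "regular i f" if "E (z powi i) Q \<noteq> 0" for i
    unfolding regular_def val_def using * that
    by (intro exI[of _ "E (z powi i) P * inverse (E (z powi i) Q)"] exI[of _ P] exI[of _ Q])
      (simp add: mult.assoc)
  then show ?thesis by (intro finite_subset[OF _ finite_roots[OF *(1)]]) blast
qed

text \<open>The function \<open>f + \<sigma> f\<close> has a pole at the last pole of \<open>f\<close> in the orbit of \<open>1\<close>, and
  another one immediately before the first pole of \<open>f\<close>.\<close>

lemma single_pole_not_coboundary:
  assumes h: "\<And>j. j \<noteq> i \<Longrightarrow> regular j h" "\<not> regular i h" and f: "f \<in> F"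
  shows "h \<noteq> f + y * f * inverse y"
proof
  assume hf: "h = f + y * f * inverse y"
  let ?P = "{j. \<not> regular j f}"
  have fin: "finite ?P" by (rule finite_poles[OF f])
  have ne: "?P \<noteq> {}"
  proof
    assume "?P = {}"
    then have "regular i f" "regular i (y * f * inverse y)" by (auto simp: regular_conj)
    then show False using h(2) regular_add hf by blast
  qed
  have Max: "Max ?P = i"
  proof (rule ccontr)
    assume "Max ?P \<noteq> i"
    moreover have "regular (Max ?P + 1) f"
      using Max_ge[OF fin, of "Max ?P + 1"] by auto
    ultimately have "regular (Max ?P) (h - y * f * inverse y)"
      using h(1) by (intro regular_diff) (auto simp: regular_conj)
    then show False using Max_in[OF fin ne] by (simp add: hf)
  qed
  have "Min ?P \<le> i" using Min_le[OF fin Max_in[OF fin ne]] Max by simp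
  then have "regular (Min ?P - 1) h" using h(1) by simp
  moreover have "regular (Min ?P - 1) f"
    using Min_le[OF fin, of "Min ?P - 1"] by auto
  ultimately have "regular (Min ?P - 1) (h - f)" by (rule regular_diff)
  then have "regular (Min ?P) f" by (simp add: hf regular_conj)
  then show False using Min_in[OF fin ne] by simp
qed

text \<open>\<open>inverse h\<close> has the value 0 at the point. Were a positive power of
  \<open>h\<close> regular there, its product with the same power of \<open>inverse h\<close>, which
  is 1, would have the value 0.\<close>

lemma pole_power_not_coboundary:
  assumes h: "\<And>j. j \<noteq> i \<Longrightarrow> regular j h" and pole: "h \<noteq> 0" "val (z powi i) (inverse h) 0"
    and f: "f \<in> F"
  shows "h ^ Suc n \<noteq> f + y * f * inverse y"
proof (rule single_pole_not_coboundary[OF regular_power[OF h] _ f])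
  show "\<not> regular i (h ^ Suc n)"
  proof
    assume "regular i (h ^ Suc n)"
    then obtain v where v: "val (z powi i) (h ^ Suc n) v" by (auto simp: regular_def)
    obtain w where "val (z powi i) (inverse h ^ n) w"
      using pole(2) regular_power[of i "inverse h" n] by (auto simp: regular_def)
    then have "val (z powi i) (inverse h ^ Suc n) (0 * w)"
      using val_mult[OF pole(2)] by simp
    then have "val (z powi i) (h ^ Suc n * inverse h ^ Suc n) (v * (0 * w))"
      by (intro val_mult[OF v]) simp_all
    moreover have "h ^ Suc n * inverse h ^ Suc n = 1"
      using pole(1) by (simp only: power_inverse) (rule right_inverse, simp)
    ultimately have "val (z powi i) 1 0" by simp
    moreover have "val (z powi i) 1 1" using val_E[of _ 1] by simp
    ultimately show False using val_unique[of "z powi i" 1 0 1] by simp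
  qed
qed

section \<open>The zeros and poles of \<open>g\<close>\<close>

definition g where "g = inverse (1 - x) * (1 - z * x)"

lemma x_neq_1: "1 - x \<noteq> 0" and zx_neq_1: "1 - z * x \<noteq> 0"
  using E_x_eq_0[of "[:1, -1:]" 0] E_x_eq_0[of "[:1, - t:]" 0] by (auto simp: \<phi>_simps)

lemma g_nonzero: "g \<noteq> 0"
  using x_neq_1 zx_neq_1 by (simp add: g_def)

text \<open>The quotient (1 - z x)/(1 - x) has its pole at 1 and its zero at the inverse of
  \<open>z\<close>; inversion exchanges them, so both functions have a single pole in the
  orbit.\<close>

lemma regular_g: "j \<noteq> 0 \<Longrightarrow> regular j g"
  and val_g: "val (z powi (-1)) g 0"
proof -
  have "g * (1 - x) = inverse (1 - x) * ((1 - x) * (1 - z * x))"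
    using zx by (simp add: g_def algebra_simps)
  then have gx: "g * (1 - x) = 1 - z * x" using x_neq_1 by (simp add: mult.assoc[symmetric])
  have v: "val r g v" if "1 - r \<noteq> 0" "v * (1 - r) = 1 - z * r" for r v
    unfolding val_def using that gx
    by (intro exI[of _ "[:1, -t:]"] exI[of _ "[:1, -1:]"]) (simp add: \<phi>_simps)
  show "regular j g" if "j \<noteq> 0" for j
  proof -
    have "1 - z powi j \<noteq> 0" using that z_powi_eq_1[of j] by simp
    then have "val (z powi j) g ((1 - z * z powi j) * inverse (1 - z powi j))"
      by (intro v) (simp_all add: mult.assoc)
    then show ?thesis unfolding regular_def by blast
  qed
  show "val (z powi (-1)) g 0"
    using z_powi_eq_1[of "-1"] z_nonzero by (intro v) auto
qed

lemma regular_inverse_g: "j \<noteq> -1 \<Longrightarrow> regular j (inverse g)"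
  and val_inverse_g: "val (z powi 0) (inverse g) 0"
proof -
  have ig: "inverse g = inverse (1 - z * x) * (1 - x)"
    using x_neq_1 zx_neq_1 by (simp add: g_def nonzero_inverse_mult_distrib)
  have "inverse g * (1 - z * x) = inverse (1 - z * x) * ((1 - z * x) * (1 - x))"
    using zx by (simp add: ig algebra_simps)
  then have gx: "inverse g * (1 - z * x) = 1 - x" using zx_neq_1 by (simp add: mult.assoc[symmetric])
  have v: "val r (inverse g) v" if "1 - z * r \<noteq> 0" "v * (1 - z * r) = 1 - r" for r v
    unfolding val_def using that gx
    by (intro exI[of _ "[:1, -1:]"] exI[of _ "[:1, -t:]"]) (simp add: \<phi>_simps)
  show "regular j (inverse g)" if "j \<noteq> -1" for j
  proof -
    have "z * z powi j = z powi (j + 1)" using z_nonzero by (simp add: power_int_add_1')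
    then have "1 - z * z powi j \<noteq> 0" using that z_powi_eq_1[of "j + 1"] by auto
    then have "val (z powi j) (inverse g) ((1 - z powi j) * inverse (1 - z * z powi j))"
      by (intro v) (simp_all add: mult.assoc)
    then show ?thesis unfolding regular_def by blast
  qed
  show "val (z powi 0) (inverse g) 0"
    using z_powi_eq_1[of 1] by (intro v) auto
qed

text \<open>Splitting off powers of \<open>x\<close> leaves a factor with nonzero value at 0, the
  point fixed by scaling with \<open>z\<close>.\<close>

lemma lowest_term:
  "E x P \<noteq> 0 \<Longrightarrow> \<exists>a R. E x P = E x R * x ^ a \<and> E 0 R \<noteq> 0"
proof (induction P)
  case (pCons b P)
  show ?case
  proof (cases "\<phi> b = 0")
    case True
    then have "E x P \<noteq> 0" using pCons.prems by auto
    then obtain a R where "E x P = E x R * x ^ a" "E 0 R \<noteq> 0" using pCons.IH by blast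
    then show ?thesis using True
      by (intro exI[of _ "Suc a"] exI[of _ R]) (simp add: mult.assoc power_commutes)
  next
    case False
    then show ?thesis by (intro exI[of _ 0] exI[of _ "pCons b P"]) simp
  qed
qed simp

text \<open>Write \<open>f = f1 * x^a / x^b\<close> with \<open>f1\<close> regular and nonzero at \<open>0\<close> and compare the values
  at \<open>0\<close>, after clearing the powers of \<open>x\<close>.\<close>

lemma one_not_coboundary':
  assumes "f \<in> F"
  shows "f - y * f * inverse y \<noteq> 1"
proof
  assume eq: "f - y * f * inverse y = 1"
  obtain P Q where PQ: "E x Q \<noteq> 0" "f * E x Q = E x P" using assms unfolding F_def by blast
  have "f \<noteq> 0" using eq by auto
  then have "E x P \<noteq> 0" using PQ by (metis mult_eq_0_iff)
  then obtain a P1 where P1: "E x P = E x P1 * x ^ a" "E 0 P1 \<noteq> 0" using lowest_term by blast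
  obtain b Q1 where Q1: "E x Q = E x Q1 * x ^ b" "E 0 Q1 \<noteq> 0" using lowest_term PQ(1) by blast
  have Q1_nz: "E x Q1 \<noteq> 0" using PQ(1) Q1(1) by auto
  define f1 where "f1 = E x P1 * inverse (E x Q1)"
  define v where "v = E 0 P1 * inverse (E 0 Q1)"
  have val_f1: "val 0 f1 v"
    unfolding val_def f1_def v_def using Q1_nz Q1(2)
    by (intro exI[of _ P1] exI[of _ Q1]) (simp add: mult.assoc)
  have v: "v \<noteq> 0" using P1(2) Q1(2) by (simp add: v_def)
  have Fs: "f1 \<in> F" "x ^ n \<in> F" for n using val_F[OF val_f1] F_power F_x by auto
  have "f * x ^ b * E x Q1 = f1 * x ^ a * E x Q1"
  proof -
    have "f * x ^ b * E x Q1 = f * E x Q"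
      using F_commute[OF E_F Fs(2), of Q1 b] by (simp add: Q1(1) mult.assoc)
    also have "\<dots> = (f1 * E x Q1) * x ^ a" using Q1_nz by (simp add: PQ(2) P1(1) f1_def mult.assoc)
    finally show ?thesis using F_commute[OF E_F Fs(2), of Q1 a] by (simp add: mult.assoc)
  qed
  then have f_eq: "f * x ^ b = f1 * x ^ a" using Q1_nz by simp
  define f2 where "f2 = y * f1 * inverse y"
  \<comment> \<open>Multiplication by \<open>z\<close> fixes the point 0, so \<open>f1\<close> and
    its conjugate take the same value there.\<close>
  have "val (z * 0) f1 v" using val_f1 by simp
  then have val_f2: "val 0 f2 v" unfolding f2_def by (rule val_conj) simp
  have f2_F: "f2 \<in> F" by (rule val_F[OF val_f2])
  have conj_mult: "y * (p * q) * inverse y = (y * p * inverse y) * (y * q * inverse y)" for p q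
    using y_nonzero' by (simp add: mult.assoc) (simp add: mult.assoc[symmetric])
  have conj_x: "y * x ^ n * inverse y = z ^ n * x ^ n" for n
  proof (induction n)
    case 0
    then show ?case using y_nonzero' by simp
  next
    case (Suc n)
    have "y * x * inverse y = z * x" using yx y_nonzero' by (simp add: mult.assoc)
    then have "y * x ^ Suc n * inverse y = z * x * (z ^ n * x ^ n)"
      by (simp only: power_Suc conj_mult Suc)
    also have "\<dots> = z * (x * z ^ n) * x ^ n" by (simp only: mult.assoc)
    also have "x * z ^ n = z ^ n * x" using zx by (metis power_commuting_commutes)
    finally show ?case by (simp add: mult.assoc)
  qed
  have sf: "y * f * inverse y * (z ^ b * x ^ b) = f2 * (z ^ a * x ^ a)"
    using arg_cong[OF f_eq, of "\<lambda>h. y * h * inverse y"] by (simp only: conj_mult conj_x f2_def)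
  have zF: "z ^ n \<in> F" for n by (rule F_power[OF F_z])
  have "z ^ b * x ^ b = (f - y * f * inverse y) * (z ^ b * x ^ b)" by (simp only: eq mult_1_left)
  also have "\<dots> = f * (z ^ b * x ^ b) - f2 * (z ^ a * x ^ a)"
    by (simp only: left_diff_distrib sf)
  also have "\<dots> = f * x ^ b * z ^ b - f2 * (z ^ a * x ^ a)"
    by (simp only: F_commute[OF zF Fs(2)] mult.assoc)
  also have "\<dots> = f1 * x ^ a * z ^ b - f2 * (z ^ a * x ^ a)" by (simp only: f_eq)
  also have "\<dots> = (f1 * z ^ b - f2 * z ^ a) * x ^ a"
    by (simp only: left_diff_distrib mult.assoc F_commute[OF zF Fs(2)])
  finally have main: "(f1 * z ^ b - f2 * z ^ a) * x ^ a = z ^ b * x ^ b" ..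
  have val_z: "val 0 (z ^ n) (z ^ n)" for n
    using val_E[of 0 "[:t ^ n:]"] by (simp add: ring_map_power[OF ring_map_\<phi>] \<phi>_simps)
  have val_x: "val 0 (x ^ n) (if n = 0 then 1 else 0)" for n
  proof (induction n)
    case 0
    then show ?case using val_E[of 0 1] by simp
  next
    case (Suc n)
    have "val 0 x 0" using val_E[of 0 "[:0, 1:]"] by (simp add: \<phi>_simps)
    from val_mult[OF this Suc] show ?case by simp
  qed
  have val_w: "val 0 (f1 * z ^ b - f2 * z ^ a) (v * (z ^ b - z ^ a))"
    using val_add[OF val_mult[OF val_f1 val_z[of b]] val_uminus[OF val_mult[OF val_f2 val_z[of a]]]]
    by (simp add: right_diff_distrib)
  show False
  \<comment> \<open>If \<open>b \<le> a\<close>, the left side divided by \<open>x ^ b\<close>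
    vanishes at 0, through a factor \<open>x\<close> when \<open>b < a\<close> and through
    \<open>z ^ b - z ^ a\<close> when \<open>a = b\<close>, while the right side does not. If
    \<open>a < b\<close>, division by \<open>x ^ a\<close> makes the right side vanish at 0, which
    forces \<open>z ^ b = z ^ a\<close>.\<close>
  proof (cases "b \<le> a")
    case True
    then have "x ^ a = x ^ (a - b) * x ^ b" by (simp add: power_add[symmetric])
    then have "(f1 * z ^ b - f2 * z ^ a) * x ^ (a - b) = z ^ b"
      using main x_nonzero by (simp add: mult.assoc[symmetric])
    then have "val 0 (z ^ b) (v * (z ^ b - z ^ a) * (if a - b = 0 then 1 else 0))"
      using val_mult[OF val_w val_x[of "a - b"]] by simp
    then have "z ^ b = v * (z ^ b - z ^ a) * (if a - b = 0 then 1 else 0)"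
      by (rule val_unique[OF val_z]) simp
    then show False using True z_nonzero by (auto split: if_splits)
  next
    case False
    then have "x ^ b = x ^ (b - a) * x ^ a" by (simp add: power_add[symmetric])
    then have "f1 * z ^ b - f2 * z ^ a = z ^ b * x ^ (b - a)"
      using main x_nonzero by (simp add: mult.assoc[symmetric])
    then have "val 0 (f1 * z ^ b - f2 * z ^ a) (z ^ b * 0)"
      using val_mult[OF val_z[of b] val_x[of "b - a"]] False by simp
    from val_unique[OF val_w this] have "z ^ b - z ^ a = 0" using v by simp
    moreover have "z ^ b = z ^ (b - a) * z ^ a" using False by (simp add: power_add[symmetric])
    ultimately have "z ^ (b - a) = 1" using z_nonzero by simp
    then show False using z_order[of "b - a"] False by simp
  qed
qed

sublocale skew_extension F y
proof
  show "c i = 0" if c: "\<And>i. c i \<in> F" and s: "(\<Sum>i\<le>n. c i * y ^ i) = 0" and i: "i \<le> n" for c n i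
  \<comment> \<open>Here \<open>x\<close> and \<open>y\<close> exchange roles: \<open>x\<close>
    commutes with the coefficients because \<open>F\<close> is commutative, and the eigenvalue is
    \<open>inverse z\<close>.\<close>
  proof (rule powers_independent_eigen[OF _ y_nonzero' x_nonzero _ _ _ _ _ s i])
    show "x * y = inverse z * y * x"
      using yx z_nonzero commute_inverse_z[OF zy[symmetric]]
      by (metis mult.assoc left_inverse mult_1_left)
    show "inverse z * x = x * inverse z" by (rule commute_inverse_z[OF zx[symmetric], symmetric])
    show "inverse z * y = y * inverse z" by (rule commute_inverse_z[OF zy[symmetric], symmetric])
    show "inverse z ^ n \<noteq> 1" if "0 < n" for n
      using z_order[OF that] by (metis inverse_1 inverse_inverse_eq power_inverse)
    show "x * c i = c i * x" "inverse z * c i = c i * inverse z" for i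
      by (auto intro!: F_commute F_x F_inverse F_z c)
  qed
qed (fact F_zero F_one F_add F_uminus F_mult F_inverse F_conj one_not_coboundary' y_nonzero'
    two_nonzero')+

lemma noncob_g: "noncob (g ^ Suc n)" "noncob (inverse g ^ Suc n)"
proof -
  have "val (z powi (-1)) (inverse (inverse g)) 0" using val_g by simp
  then show "noncob (g ^ Suc n)" "noncob (inverse g ^ Suc n)"
    unfolding noncob_def \<sigma>_def
    using pole_power_not_coboundary[OF regular_g g_nonzero val_inverse_g]
      pole_power_not_coboundary[OF regular_inverse_g] g_nonzero
      F_power[OF val_F[OF val_g]] F_power[OF F_inverse[OF val_F[OF val_g]]] 
    by (auto simp del: power_Suc)
qed

end

section \<open>Involutions\<close>

locale ring_involution =
  fixes s :: "'a::division_ring \<Rightarrow> 'a"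
  assumes s_add: "s (a + b) = s a + s b" and s_mult: "s (a * b) = s b * s a"
    and s_s [simp]: "s (s a) = a"
begin

lemma s_1 [simp]: "s 1 = 1"
  using s_mult[of "s 1" 1] by simp

lemma s_0 [simp]: "s 0 = 0"
  using s_add[of 0 0] by simp

lemma s_uminus: "s (- a) = - s a"
  using s_add[of a "- a"] by (simp add: eq_neg_iff_add_eq_0 add.commute)

lemma s_diff: "s (a - b) = s a - s b"
  using s_add[of a "- b"] by (simp add: s_uminus)

lemma s_inverse: "s (inverse a) = inverse (s a)"
proof (cases "a = 0")
  case False
  then have "s a * s (inverse a) = 1" by (simp flip: s_mult)
  then show ?thesis by (simp add: inverse_unique)
qed simp

lemma s_power: "s (a ^ n) = s a ^ n"
  by (induction n) (simp_all add: s_mult power_commutes)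

lemma s_of_nat: "s (of_nat n) = of_nat n"
  by (induction n) (simp_all add: s_add)

lemma s_of_int: "s (of_int i) = of_int i"
  by (cases i) (simp_all add: s_of_nat s_uminus s_diff)

lemma s_ev:
  assumes "ring_map \<psi>" "\<And>a. s (\<psi> a) \<in> F" "s r \<in> F" "0 \<in> F"
    "\<And>a b. \<lbrakk>a \<in> F; b \<in> F\<rbrakk> \<Longrightarrow> a + b \<in> F" "\<And>a b. \<lbrakk>a \<in> F; b \<in> F\<rbrakk> \<Longrightarrow> a * b \<in> F"
  shows "s (ev \<psi> r p) \<in> F"
  by (induction p) (simp_all add: assms s_add s_mult)

end

locale quantum_plane_involution = quantum_plane + ring_involution +
  assumes s_x: "s x = x \<or> s x = inverse x" and s_y: "s y = y \<or> s y = inverse y"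
begin

lemma conj_inverse_F: "f \<in> F \<Longrightarrow> inverse y * f * y \<in> F"
proof -
  assume "f \<in> F"
  moreover have "y * (inverse y * f * y) * inverse y = f"
    using y_nonzero by (simp add: mult.assoc) (simp add: mult.assoc[symmetric])
  ultimately have "val x (y * (inverse y * f * y) * inverse y) f"
    by (simp only: F_val_x)
  then have "val (z * x) (inverse y * f * y) f" by (rule val_conj_inverse) simp
  then show ?thesis by (rule val_F)
qed

lemma s_x_F: "s x \<in> F"
  using s_x F_x inverse_F by auto

text \<open>\<open>z\<close> is a commutator of \<open>x\<close> and \<open>y\<close>, so
  \<open>s z\<close> is built from \<open>s x\<close> and its conjugate by \<open>y\<close> or
  \<open>inverse y\<close>, and \<open>F\<close> is stable under both conjugations.\<close>

lemma s_z_F: "s z \<in> F"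
proof -
  have nz: "s x \<noteq> 0" "s y \<noteq> 0" using s_x s_y x_nonzero y_nonzero by auto
  have "s x * s y = s y * s x * s z"
    using arg_cong[OF yx, of s] by (simp only: s_mult mult.assoc)
  then have "inverse (s x) * (inverse (s y) * s x * s y) = inverse (s x) * (inverse (s y) * (s y * s x * s z))"
    by (simp only: mult.assoc)
  also have "\<dots> = s z" using nz by (simp add: mult.assoc) (simp add: mult.assoc[symmetric])
  finally have "s z = inverse (s x) * (inverse (s y) * s x * s y)" ..
  moreover have "inverse (s y) * s x * s y \<in> F"
    using s_y conj_F[OF s_x_F] conj_inverse_F[OF s_x_F] by auto
  ultimately show ?thesis using mult_F inverse_F s_x_F by simp
qed

lemma s_F:
  assumes "f \<in> F"
  shows "s f \<in> F"
proof -
  have "of_int i \<in> F" for i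
  proof -
    have "of_nat n \<in> F" for n by (induction n) (simp_all add: zero_F one_F add_F)
    then show ?thesis by (cases i) (auto simp del: of_nat_Suc intro!: uminus_F)
  qed
  then have "s (of_int i) \<in> F" for i by (simp add: s_of_int)
  then have "s (ev of_int z p) \<in> F" for p
    by (rule s_ev[OF ring_map_of_int _ s_z_F zero_F add_F mult_F])
  then have "s (\<phi> a) \<in> F" for a
    unfolding \<phi>_def using inverse_F[OF s_z_F]
    by (intro s_ev[OF ring_map_z _ _ zero_F add_F mult_F]) (simp_all add: s_inverse)
  then have E: "s (E x P) \<in> F" for P
    unfolding E_def by (rule s_ev[OF ring_map_\<phi> _ s_x_F zero_F add_F mult_F])
  obtain P Q where PQ: "E x Q \<noteq> 0" "f * E x Q = E x P" using assms unfolding F_def by blast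
  have "f = E x P * inverse (E x Q)" using PQ by (metis mult.assoc mult_1_right right_inverse)
  then have "s f = inverse (s (E x Q)) * s (E x P)" by (simp add: s_mult s_inverse)
  then show ?thesis using E mult_F inverse_F by simp
qed

text \<open>Applying \<open>s\<close> to \<open>s b = f + \<sigma> f\<close> gives \<open>b\<close>
  as the sum of \<open>s f\<close> and a conjugate of it. The conjugation is \<open>\<sigma>\<close>
  if \<open>s y\<close> is \<open>inverse y\<close>; if \<open>s y = y\<close> it is the inverse of
  \<open>\<sigma>\<close>, and the conjugate \<open>h\<close> takes over the part of
  \<open>f\<close>.\<close>

lemma noncob_s:
  assumes "noncob b"
  shows "noncob (s b)"
  unfolding noncob_def
proof (intro conjI ballI notI)
  show "s b \<in> F" by (rule s_F[OF noncob_in_F[OF assms]])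
  fix f assume f: "f \<in> F" and eq: "s b = f + \<sigma> f"
  have b: "b = s f + inverse (s y) * s f * s y"
    using arg_cong[OF eq, of s] by (simp add: s_add \<sigma>_def s_mult s_inverse mult.assoc)
  show False
  proof (cases "s y = y")
    case True
    define h where "h = inverse y * s f * y"
    have "\<sigma> h = s f"
      using y_nonzero by (simp add: h_def \<sigma>_def mult.assoc) (simp add: mult.assoc[symmetric])
    then have "b = h + \<sigma> h" using b True by (simp add: h_def add.commute)
    moreover have "h \<in> F" unfolding h_def by (rule conj_inverse_F[OF s_F[OF f]])
    ultimately show False using assms unfolding noncob_def by blast
  next
    case False
    then have "b = s f + \<sigma> (s f)" using b s_y by (simp add: \<sigma>_def)
    then show False using assms s_F[OF f] unfolding noncob_def by blast
  qed
qed

text \<open>Replacing \<open>y\<close> by its inverse in (1 - y)/(1 + y) changes the sign.\<close>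

lemma s_cayley: "s (cayley (-1)) = cayley (-1) \<or> s (cayley (-1)) = - cayley (-1)"
proof -
  have nz: "1 + y \<noteq> 0" using linear_nonzero[of "-1"] by (simp add: signs_def)
  have "(1 + y) * ((1 - y) * inverse (1 + y)) = (1 - y) * ((1 + y) * inverse (1 + y))"
    by (simp only: mult.assoc[symmetric]) (simp add: algebra_simps)
  then have "(1 + y) * ((1 - y) * inverse (1 + y)) = 1 - y" using nz by simp
  then have "inverse (1 + y) * ((1 + y) * ((1 - y) * inverse (1 + y))) = inverse (1 + y) * (1 - y)"
    by simp
  then have comm: "(1 - y) * inverse (1 + y) = inverse (1 + y) * (1 - y)"
    using nz by (simp only: mult.assoc[symmetric]) (simp add: mult.assoc)
  have c: "cayley (-1) = (1 - y) * inverse (1 + y)" by (simp add: cayley_def T_def)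
  have sc: "s (cayley (-1)) = inverse (1 + s y) * (1 - s y)"
    by (simp add: c s_mult s_inverse s_add s_diff)
  show ?thesis
  proof (cases "s y = y")
    case True
    then show ?thesis using sc c comm by simp
  next
    case False
    then have y: "s y = inverse y" using s_y by simp
    have "1 + inverse y = inverse y * (1 + y)" "1 - inverse y = inverse y * (y - 1)"
      using y_nonzero by (simp_all add: algebra_simps)
    then have "s (cayley (-1)) = inverse (1 + y) * y * (inverse y * (y - 1))"
      using y_nonzero nz by (simp add: sc y nonzero_inverse_mult_distrib)
    also have "\<dots> = inverse (1 + y) * (y - 1)"
      using y_nonzero by (simp add: mult.assoc) (simp add: mult.assoc[symmetric])
    also have "\<dots> = - cayley (-1)" unfolding c comm by (simp add: algebra_simps)
    finally show ?thesis by blast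
  qed
qed

lemma free_symmetric_pair:
  assumes N: "is_normal_subgroup N" and y: "y \<in> N" and sN: "\<And>a. a \<in> N \<Longrightarrow> s a \<in> N"
  shows "\<exists>u\<in>N. \<exists>v\<in>N. s u = u \<and> s v = v \<and> free_pair u v"
proof -
  have N_mult: "a * b \<in> N" if "a \<in> N" "b \<in> N" for a b
    using N that by (auto simp: is_normal_subgroup_def is_subgroup_def)
  have N_inverse: "inverse a \<in> N" if "a \<in> N" for a
    using N that by (auto simp: is_normal_subgroup_def is_subgroup_def)
  have N_conj: "inverse a * b * a \<in> N" if "b \<in> N" "a \<noteq> 0" for a b
    using N that by (auto simp: is_normal_subgroup_def units_mult_def)
  define d where "d = cayley (-1)"
  have "cayley 1 * d = 1" "d * cayley 1 = 1"
    using cayley_inverse[of 1] cayley_inverse[of "-1"] by (simp_all add: signs_def d_def)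
  then have d: "d \<noteq> 0" "cayley 1 = inverse d" by (auto simp: inverse_unique)
  have "inverse (1 - x) * y * (1 - x) * inverse y = g"
  proof -
    have "y * (1 - x) * inverse y = 1 - z * x"
      using y_nonzero yx by (simp add: algebra_simps)
    then show ?thesis by (simp add: g_def mult.assoc)
  qed
  then have gN: "g \<in> N" using N_mult[OF N_conj[OF y x_neq_1] N_inverse[OF y]] by simp
  define c where "c = d * g * inverse d"
  have cN: "c \<in> N" using N_conj[OF gN, of "inverse d"] d by (simp add: c_def)
  \<comment> \<open>A possible sign in \<open>s d\<close> cancels, because \<open>d\<close> occurs
    together with its inverse.\<close>
  have sc: "s c = inverse d * s g * d"
    using s_cayley d(1) by (auto simp: c_def s_mult s_inverse d_def[symmetric] mult.assoc)
  have "noncob (s g ^ Suc n)" "noncob (inverse (s g) ^ Suc n)" for n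
    using noncob_s[OF noncob_g(1)] noncob_s[OF noncob_g(2)] by (simp_all only: s_power s_inverse)
  then have "free_pair (s g) (cayley (-1) ^ 2 * g * cayley 1 ^ 2)"
    by (intro free_pair_cayley noncob_g)
  also have "s g = d * s c * inverse d"
    using d(1) by (simp add: sc mult.assoc) (simp add: mult.assoc[symmetric])
  also have "cayley (-1) ^ 2 * g * cayley 1 ^ 2 = d * c * inverse d"
    by (simp add: d(2) c_def d_def power2_eq_square mult.assoc)
  finally have "free_pair (s c) c" using free_pair_conj d(1) by blast
  then have "free_pair (s c * c) (c * s c)" by (rule free_pair_mult_swap)
  moreover have "s (s c * c) = s c * c" "s (c * s c) = c * s c" by (simp_all add: s_mult)
  ultimately show ?thesis using N_mult cN sN by blast
qed

end

section \<open>Nilpotent groups with involution\<close>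

lemma subset_gen_subgroup: "S \<subseteq> gen_subgroup S"
  by (auto intro: gen_subgroup.gen)

lemma gen_subgroup_least: "\<lbrakk>is_subgroup H; S \<subseteq> H\<rbrakk> \<Longrightarrow> gen_subgroup S \<subseteq> H"
proof
  fix a assume H: "is_subgroup H" "S \<subseteq> H"
  assume "a \<in> gen_subgroup S"
  then show "a \<in> H" using H by induction (auto simp: is_subgroup_def)
qed

lemma gen_subgroup_mono: "S \<subseteq> S' \<Longrightarrow> gen_subgroup S \<subseteq> gen_subgroup S'"
proof
  fix a assume S: "S \<subseteq> S'"
  assume "a \<in> gen_subgroup S"
  then show "a \<in> gen_subgroup S'" using S by induction (auto intro: gen_subgroup.intros)
qed

lemma lower_central_mono: "L \<subseteq> H \<Longrightarrow> lower_central L n \<subseteq> lower_central H n"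
proof (induction n)
  case (Suc n)
  then show ?case unfolding lower_central.simps by (intro gen_subgroup_mono) blast
qed simp

lemma commutator_lower_central:
  "\<lbrakk>a \<in> lower_central L n; b \<in> L\<rbrakk> \<Longrightarrow> commutator a b \<in> lower_central L (Suc n)"
  using subset_gen_subgroup by fastforce

lemma lower_central_subset:
  assumes "is_subgroup L"
  shows "lower_central L n \<subseteq> L"
proof (induction n)
  case (Suc n)
  have "commutator a b \<in> L" if "a \<in> L" "b \<in> L" for a b
    using assms that by (auto simp: commutator_def is_subgroup_def)
  then show ?case
    using Suc unfolding lower_central.simps by (intro gen_subgroup_least[OF assms]) blast
qed simp

context ring_involution
begin

definition central_in :: "'a set \<Rightarrow> 'a \<Rightarrow> bool" where
  "central_in L c \<longleftrightarrow> c \<in> L \<and> (\<forall>h\<in>L. h * c = c * h)"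

text \<open>\<open>x\<close> is taken from the second centre, so that \<open>z\<close> is central.
  Torsion-freeness turns \<open>c * c = 1\<close> into \<open>c = 1\<close>; hence noncommutation
  survives the passage to squares that occurs when \<open>x\<close> and \<open>y\<close> are
  adjusted to the involution.\<close>

lemma exists_quantum_pair:
  assumes L: "is_subgroup L" and sL: "\<And>a. a \<in> L \<Longrightarrow> s a \<in> L" and tf: "torsion_free L"
    and nil: "lower_central L m = {1}" and nab: "\<not> abelian_sg L"
  shows "\<exists>x\<in>L. \<exists>y\<in>L. \<exists>z\<in>L. y * x = z * x * y \<and> z * x = x * z \<and> z * y = y * z \<and> z \<noteq> 1 \<and>
    (s x = x \<or> s x = inverse x) \<and> (s y = y \<or> s y = inverse y)"
proof -
  let ?Z = "central_in L"
  \<comment> \<open>The second term of the upper central series.\<close>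
  define Z2 where "Z2 x \<longleftrightarrow> x \<in> L \<and> (\<forall>h\<in>L. \<exists>c. ?Z c \<and> h * x = c * x * h)" for x
  have L_nz: "a \<noteq> 0" if "a \<in> L" for a
    using L that by (auto simp: is_subgroup_def units_mult_def)
  have L_mult: "a * b \<in> L" if "a \<in> L" "b \<in> L" for a b
    using L that by (auto simp: is_subgroup_def)
  have L_inverse: "inverse a \<in> L" if "a \<in> L" for a
    using L that by (auto simp: is_subgroup_def)
  have L_1: "1 \<in> L" using L by (auto simp: is_subgroup_def)
  have ZD: "c \<in> L" "\<And>h. h \<in> L \<Longrightarrow> h * c = c * h" if "?Z c" for c
    using that by (auto simp: central_in_def)
  have Z_1: "?Z 1" using L_1 by (simp add: central_in_def)
  have Z_mult: "?Z (c * c')" if "?Z c" "?Z c'" for c c'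
    unfolding central_in_def using ZD[OF that(1)] ZD[OF that(2)] L_mult
    by (metis mult.assoc)
  have Z_inverse: "?Z (inverse c)" if c: "?Z c" for c
    unfolding central_in_def
  proof (intro conjI ballI)
    show "inverse c \<in> L" by (rule L_inverse[OF ZD(1)[OF c]])
    fix h assume h: "h \<in> L"
    show "h * inverse c = inverse c * h"
      by (rule commute_inverse[OF ZD(2)[OF c h] L_nz[OF ZD(1)[OF c]]])
  qed
  have Z_s: "?Z (s c)" if c: "?Z c" for c
    unfolding central_in_def
  proof (intro conjI ballI)
    show "s c \<in> L" using sL ZD(1)[OF c] by blast
    fix h assume h: "h \<in> L"
    show "h * s c = s c * h"
      using arg_cong[OF ZD(2)[OF c sL[OF h]], of s] by (simp add: s_mult)
  qed
  have Z2I: "Z2 x" if "x \<in> L" "\<And>h. h \<in> L \<Longrightarrow> \<exists>c. ?Z c \<and> h * x = c * x * h" for x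
    using that by (auto simp: Z2_def)
  have Z2E: "\<exists>c. ?Z c \<and> h * x = c * x * h" if "Z2 x" "h \<in> L" for x h
    using that by (auto simp: Z2_def)
  have Z2_L: "x \<in> L" if "Z2 x" for x using that by (simp add: Z2_def)
  have Z2_mult: "Z2 (x * x')" if x: "Z2 x" "Z2 x'" for x x'
  proof (rule Z2I)
    show "x * x' \<in> L" using x L_mult Z2_L by blast
    fix h assume h: "h \<in> L"
    obtain c c' where c: "?Z c" "h * x = c * x * h" "?Z c'" "h * x' = c' * x' * h"
      using Z2E[OF x(1) h] Z2E[OF x(2) h] by blast
    have "h * (x * x') = c * x * (h * x')" by (simp add: mult.assoc[symmetric] c(2))
    also have "\<dots> = c * (x * c') * x' * h" by (simp add: c(4) mult.assoc)
    also have "x * c' = c' * x" by (rule ZD(2)[OF c(3) Z2_L[OF x(1)]])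
    finally show "\<exists>c. ?Z c \<and> h * (x * x') = c * (x * x') * h"
      using Z_mult[OF c(1,3)] by (intro exI[of _ "c * c'"]) (simp add: mult.assoc)
  qed
  have Z2_inverse: "Z2 (inverse x)" if x: "Z2 x" for x
  proof (rule Z2I)
    show "inverse x \<in> L" using x L_inverse Z2_L by blast
    fix h assume h: "h \<in> L"
    obtain c where c: "?Z c" "h * x = c * x * h"
      using Z2E[OF x h] by blast
    have nz: "x \<noteq> 0" "c \<noteq> 0" using L_nz Z2_L[OF x] ZD(1)[OF c(1)] by auto
    have "c * x = x * c" using ZD(2)[OF c(1) Z2_L[OF x]] by simp
    then have "inverse x * (h * x) * inverse x = c * (h * inverse x)"
      using nz by (simp add: c(2) mult.assoc) (simp add: mult.assoc[symmetric])
    then have "inverse c * (inverse x * h) = inverse c * (c * (h * inverse x))"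
      using nz by (simp add: mult.assoc)
    then have "h * inverse x = inverse c * inverse x * h"
      using nz by (simp add: mult.assoc) (simp add: mult.assoc[symmetric])
    then show "\<exists>c. ?Z c \<and> h * inverse x = c * inverse x * h" using Z_inverse[OF c(1)] by blast
  qed
  have Z2_s: "Z2 (s x)" if x: "Z2 x" for x
  proof (rule Z2I)
    show "s x \<in> L" using x sL Z2_L by blast
    fix k assume k: "k \<in> L"
    obtain c where c: "?Z c" "s k * x = c * x * s k"
      using Z2E[OF x sL[OF k]] by blast
    have sc: "?Z (s c)" by (rule Z_s[OF c(1)])
    have nz: "s c \<noteq> 0" using L_nz ZD(1)[OF sc] by auto
    have "s x * k = k * s x * s c" using arg_cong[OF c(2), of s] by (simp add: s_mult mult.assoc)
    also have "\<dots> = s c * (k * s x)" by (rule ZD(2)[OF sc]) (intro L_mult k sL Z2_L[OF x])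
    finally have "inverse (s c) * (s x * k) = inverse (s c) * (s c * (k * s x))" by simp
    then have "k * s x = inverse (s c) * s x * k"
      using nz by (simp add: mult.assoc) (simp add: mult.assoc[symmetric])
    then show "\<exists>c. ?Z c \<and> k * s x = c * s x * k" using Z_inverse[OF sc] by blast
  qed
  have tf': "c = 1" if "c \<in> L" "c * c = 1" for c
    using tf that unfolding torsion_free_def by (metis pos2 power2_eq_square)
  \<comment> \<open>\<open>x0\<close> comes from the last term of the lower central series that is
    not central: its commutators lie in the next term, which is.\<close>
  obtain x0 where x0: "Z2 x0" "\<not> ?Z x0"
  proof -
    let ?P = "\<lambda>n. \<forall>a\<in>lower_central L n. ?Z a"
    define n where "n = (LEAST n. ?P n)"
    have "?P m" using nil Z_1 by simp
    then have n: "?P n" unfolding n_def by (rule LeastI)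
    have "n \<noteq> 0"
    proof
      assume "n = 0"
      then have "abelian_sg L" using n by (auto simp: abelian_sg_def central_in_def)
      then show False using nab by simp
    qed
    then obtain k where k: "n = Suc k" by (cases n) auto
    have "\<not> ?P k" using not_less_Least[of k ?P] k by (simp add: n_def)
    then obtain a where a: "a \<in> lower_central L k" "\<not> ?Z a" by blast
    have aL: "a \<in> L" using lower_central_subset[OF L] a(1) by blast
    have "Z2 a"
    proof (rule Z2I[OF aL])
      fix h assume h: "h \<in> L"
      have Zc: "?Z (commutator a (inverse h))"
        using n k commutator_lower_central[OF a(1) L_inverse[OF h]] by blast
      have "h * a = a * commutator a (inverse h) * h"
        using L_nz[OF aL] L_nz[OF h] by (simp add: commutator_def mult.assoc) (simp add: mult.assoc[symmetric])
      also have "a * commutator a (inverse h) = commutator a (inverse h) * a"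
        by (rule ZD(2)[OF Zc aL])
      finally show "\<exists>c. ?Z c \<and> h * a = c * a * h" using Zc by blast
    qed
    then show ?thesis using a(2) that by blast
  qed
  have x0L: "x0 \<in> L" by (rule Z2_L[OF x0(1)])
  \<comment> \<open>If \<open>x0 * s x0\<close> is not central, it is a symmetric choice. Otherwise
    \<open>x0 * inverse (s x0)\<close> is inverted by \<open>s\<close>; it equals
    \<open>x0 * x0\<close> up to a central factor, and a central square would make \<open>x0\<close>
    central by torsion-freeness.\<close>
  obtain x where x: "Z2 x" "\<not> ?Z x" "s x = x \<or> s x = inverse x"
  proof (cases "?Z (x0 * s x0)")
    case False
    then show ?thesis
      using that[of "x0 * s x0"] Z2_mult[OF x0(1) Z2_s[OF x0(1)]] by (simp add: s_mult)
  next
    case True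
    define \<zeta> where "\<zeta> = x0 * s x0"
    define x where "x = x0 * inverse (s x0)"
    have nz: "x0 \<noteq> 0" "s x0 \<noteq> 0" "\<zeta> \<noteq> 0" using L_nz x0L sL by (auto simp: \<zeta>_def)
    have \<zeta>: "?Z \<zeta>" using True by (simp add: \<zeta>_def)
    have comm: "x0 * s x0 = s x0 * x0"
    proof -
      have "x0 * (x0 * s x0) = x0 * s x0 * x0" using ZD(2)[OF \<zeta> x0L] by (simp add: \<zeta>_def)
      then show ?thesis using nz by (simp add: mult.assoc)
    qed
    have "s x0 * inverse x0 = inverse x0 * (x0 * s x0) * inverse x0"
      using nz by (simp add: mult.assoc[symmetric])
    also have "\<dots> = inverse x0 * s x0" using nz by (simp add: comm mult.assoc)
    finally have "s x = inverse x"
      using nz by (simp add: x_def s_mult s_inverse nonzero_inverse_mult_distrib)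
    moreover have "Z2 x" unfolding x_def by (intro Z2_mult Z2_inverse Z2_s x0)
    moreover have "\<not> ?Z x"
    proof
      assume "?Z x"
      moreover have "x * \<zeta> = x0 * x0"
        using nz by (simp add: x_def \<zeta>_def comm mult.assoc) (simp add: mult.assoc[symmetric])
      ultimately have sq: "?Z (x0 * x0)" using Z_mult[of x \<zeta>] \<zeta> by simp
      obtain h where h: "h \<in> L" "h * x0 \<noteq> x0 * h"
        using x0(2) x0L by (auto simp: central_in_def)
      obtain c where c: "?Z c" "h * x0 = c * x0 * h" using Z2E[OF x0(1) h(1)] by blast
      have "h * (x0 * x0) = (h * x0) * x0" by (simp only: mult.assoc)
      also have "\<dots> = c * x0 * (h * x0)" by (simp only: c(2) mult.assoc)
      also have "\<dots> = c * (x0 * c) * x0 * h" by (simp only: c(2) mult.assoc)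
      also have "x0 * c = c * x0" by (rule ZD(2)[OF c(1) x0L])
      finally have "(x0 * x0 * h) = c * c * (x0 * x0 * h)"
        using ZD(2)[OF sq h(1)] by (simp add: mult.assoc)
      then have "c * c = 1" using nz(1) L_nz[OF h(1)] by simp
      then have "c = 1" using tf' ZD(1)[OF c(1)] by blast
      then show False using c(2) h(2) by simp
    qed
    ultimately show ?thesis using that by blast
  qed
  have xL: "x \<in> L" by (rule Z2_L[OF x(1)])
  obtain y0 where y0: "y0 \<in> L" "y0 * x \<noteq> x * y0"
    using x(2) xL by (auto simp: central_in_def)
  \<comment> \<open>The symmetric element \<open>y0 * s y0\<close> serves if it does not commute
    with \<open>x\<close>; otherwise \<open>y0\<close> is corrected until \<open>y * s y\<close> is
    1.\<close>
  have "\<exists>y\<in>L. y * x \<noteq> x * y \<and> (s y = y \<or> s y = inverse y)"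
  proof (cases "x * (y0 * s y0) = y0 * s y0 * x")
    case False
    then show ?thesis
      using y0 sL L_mult by (intro bexI[of _ "y0 * s y0"]) (auto simp: s_mult)
  next
    case True
    text \<open>Replacing \<open>y\<close> by \<open>w^{-1} y\<^sup>2\<close>, where \<open>w = y * s y\<close>, replaces \<open>w\<close> by a
      commutator of \<open>w\<close> and pushes it down the lower central series.\<close>
    have "\<exists>y\<in>L. y * x \<noteq> x * y \<and> x * (y * s y) = y * s y * x \<and> y * s y \<in> lower_central L n" for n
    proof (induction n)
      case 0
      show ?case using y0 True L_mult sL by auto
    next
      case (Suc n)
      then obtain y where y: "y \<in> L" "y * x \<noteq> x * y" "x * (y * s y) = y * s y * x"
        "y * s y \<in> lower_central L n" by blast
      define w where "w = y * s y"
      define y1 where "y1 = inverse w * (y * y)"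
      have wL: "w \<in> L" using y sL L_mult by (simp add: w_def)
      have nz: "y \<noteq> 0" "s y \<noteq> 0" "w \<noteq> 0" "x \<noteq> 0" using L_nz y(1) sL xL wL by auto
      have sw: "s w = w" by (simp add: w_def s_mult)
      have y1L: "y1 \<in> L" unfolding y1_def using L_mult L_inverse wL y(1) by blast
      have w1: "y1 * s y1 = commutator w (inverse y)"
      proof -
        have "y1 * s y1 = inverse w * (y * (y * s y) * s y) * inverse w"
          by (simp add: y1_def s_mult s_inverse sw mult.assoc)
        also have "y * (y * s y) * s y = y * w * inverse y * (y * s y)"
          using nz by (simp add: w_def mult.assoc) (simp add: mult.assoc[symmetric])
        finally show ?thesis using nz by (simp add: w_def[symmetric] commutator_def mult.assoc)
      qed
      obtain c where c: "?Z c" "y * x = c * x * y" using Z2E[OF x(1) y(1)] by blast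
      have c_x: "x * c = c * x" and c_y: "y * c = c * y" and c_w: "w * c = c * w"
        using ZD(2)[OF c(1)] xL y(1) wL by auto
      have wx: "x * w = w * x" using y(3) by (simp add: w_def)
      have iwx: "inverse w * x = x * inverse w"
        by (rule commute_inverse[OF wx nz(3), symmetric])
      have yyx: "y * y * x = c * c * x * (y * y)"
      proof -
        have "y * y * x = y * c * x * y" by (simp add: mult.assoc c(2))
        also have "\<dots> = c * (y * x) * y" by (simp add: c_y mult.assoc)
        finally show ?thesis by (simp add: c(2) mult.assoc)
      qed
      have c_iw: "inverse w * (c * c) = c * c * inverse w"
        using ZD(2)[OF Z_mult[OF c(1) c(1)] L_inverse[OF wL]] .
      have "y1 * x = inverse w * (y * y * x)" by (simp only: y1_def mult.assoc)
      also have "\<dots> = inverse w * (c * c) * x * (y * y)"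
        unfolding yyx by (simp only: mult.assoc)
      also have "\<dots> = c * c * (inverse w * x) * (y * y)" by (simp only: c_iw mult.assoc)
      also have "\<dots> = c * c * (x * y1)" by (simp only: iwx y1_def mult.assoc)
      finally have y1x: "y1 * x = c * c * (x * y1)" .
      have ne: "y1 * x \<noteq> x * y1"
      proof
        assume "y1 * x = x * y1"
        then have "1 * (x * y1) = c * c * (x * y1)" using y1x by simp
        then have "c * c = 1" using nz(4) L_nz[OF y1L] by (metis mult_right_cancel no_zero_divisors)
        then have "c = 1" using tf' ZD(1)[OF c(1)] by blast
        then show False using c(2) y(2) by simp
      qed
      \<comment> \<open>Moving \<open>x\<close> past \<open>y\<close> and past
        \<open>inverse y\<close> produces mutually inverse central factors.\<close>
      have ywy: "x * (y * w * inverse y) = y * w * inverse y * x"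
      proof -
        have iy: "x * y = inverse c * (y * x)" "inverse y * x = inverse c * (x * inverse y)"
        proof -
          have cnz: "c \<noteq> 0" using L_nz ZD(1)[OF c(1)] by blast
          show "x * y = inverse c * (y * x)" using cnz by (simp add: c(2) mult.assoc[symmetric])
          have "x * inverse y = inverse y * (y * x) * inverse y"
            using nz by (simp add: mult.assoc[symmetric])
          also have "\<dots> = inverse y * c * x" using nz by (simp add: c(2) mult.assoc)
          also have "inverse y * c = c * inverse y" by (rule ZD(2)[OF c(1) L_inverse[OF y(1)]])
          finally show "inverse y * x = inverse c * (x * inverse y)"
            using cnz by (simp add: mult.assoc) (simp add: mult.assoc[symmetric])
        qed
        have "y * w * inverse y * x = y * (w * inverse c) * x * inverse y"
          by (simp only: iy(2) mult.assoc)
        also have "w * inverse c = inverse c * w" by (rule ZD(2)[OF Z_inverse[OF c(1)] wL])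
        also have "y * (inverse c * w) * x * inverse y = (y * inverse c) * (w * x) * inverse y"
          by (simp only: mult.assoc)
        also have "\<dots> = (inverse c * y) * (x * w) * inverse y"
          by (simp only: wx ZD(2)[OF Z_inverse[OF c(1)] y(1)])
        also have "\<dots> = x * (y * w * inverse y)"
          by (simp only: mult.assoc) (simp only: mult.assoc[symmetric] iy(1))
        finally show ?thesis ..
      qed
      have "commutator w (inverse y) = inverse w * (y * w * inverse y)"
        using nz by (simp add: commutator_def mult.assoc)
      then have "x * (y1 * s y1) = y1 * s y1 * x"
        unfolding w1 by (metis iwx ywy mult.assoc)
      then show ?case
        using y1L ne w1 commutator_lower_central[OF y(4)[folded w_def] L_inverse[OF y(1)]] by auto
    qed
    \<comment> \<open>At depth \<open>m\<close> the lower central series is trivial, so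
      \<open>s\<close> inverts \<open>y\<close>.\<close>
    from this[of m] obtain y where "y \<in> L" "y * x \<noteq> x * y" "y * s y = 1" using nil by auto
    then show ?thesis by (metis inverse_unique)
  qed
  then obtain y where y: "y \<in> L" "y * x \<noteq> x * y" "s y = y \<or> s y = inverse y" by blast
  obtain c where c: "?Z c" "y * x = c * x * y" using Z2E[OF x(1) y(1)] by blast
  show ?thesis
    using ZD[OF c(1)] c(2) xL y x(3) by (intro bexI[of _ x] bexI[of _ y] bexI[of _ c]) auto
qed

end

section \<open>Finite index\<close>

lemma finite_index_Int:
  assumes "finite_index H G" "finite_index K G" and G: "is_subgroup G"
  shows "finite_index (H \<inter> K) G"
proof -
  let ?c = "\<lambda>H g. {h * g | h. h \<in> H}"
  have nz: "g \<noteq> 0" if "g \<in> G" for g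
    using G that by (auto simp: is_subgroup_def units_mult_def)
  have "?c (H \<inter> K) g = ?c H g \<inter> ?c K g" if "g \<in> G" for g
    using nz[OF that] by auto
  then have "{?c (H \<inter> K) g | g. g \<in> G} \<subseteq> (\<lambda>(A, B). A \<inter> B) ` ({?c H g | g. g \<in> G} \<times> {?c K g | g. g \<in> G})"
    by fastforce
  then show ?thesis
    using assms(1,2) unfolding finite_index_def by (meson finite_SigmaI finite_imageI finite_subset)
qed

context ring_involution
begin

lemma is_subgroup_image:
  assumes "is_subgroup H"
  shows "is_subgroup (s ` H)"
proof -
  have "s a \<noteq> 0" if "a \<noteq> 0" for a using that by (metis s_0 s_s)
  then show ?thesis using assms
    by (auto simp: is_subgroup_def units_mult_def s_mult[symmetric] s_inverse[symmetric] image_iff)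
      (metis s_1)+
qed

lemma finite_index_image:
  assumes "finite_index H G" "is_subgroup H" "is_subgroup G" "s ` G = G"
  shows "finite_index (s ` H) G"
proof -
  let ?c = "\<lambda>H g. {h * g | h. h \<in> H}"
  have "?c (s ` H) g = (\<lambda>a. s (inverse a)) ` ?c H (inverse (s g))" (is "?A = ?B") if g: "g \<in> G" for g
  proof -
    have "g \<noteq> 0" using g assms(3) by (auto simp: is_subgroup_def units_mult_def)
    then have sg: "s g \<noteq> 0" by (metis s_0 s_s)
    have nz: "h \<noteq> 0" if "h \<in> H" for h using that assms(2) by (auto simp: is_subgroup_def units_mult_def)
    have *: "s (inverse (h * inverse (s g))) = s (inverse h) * g" if "h \<in> H" for h
      using nz[OF that] sg by (simp add: nonzero_inverse_mult_distrib s_mult)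
    have inv: "inverse h \<in> H" if "h \<in> H" for h using that assms(2) by (auto simp: is_subgroup_def)
    show ?thesis
    proof
      show "?A \<subseteq> ?B"
      proof
        fix a assume "a \<in> ?A"
        then obtain h where h: "h \<in> H" "a = s h * g" by auto
        then have "a = s (inverse (inverse h * inverse (s g)))" using *[OF inv[OF h(1)]] by simp
        then show "a \<in> ?B" using inv[OF h(1)] by blast
      qed
      show "?B \<subseteq> ?A" using * inv by auto
    qed
  qed
  moreover have "inverse (s g) \<in> G" if "g \<in> G" for g
    using that assms(3,4) by (auto simp: is_subgroup_def)
  ultimately have "{?c (s ` H) g | g. g \<in> G} \<subseteq> (\<lambda>A. (\<lambda>a. s (inverse a)) ` A) ` {?c H g | g. g \<in> G}"
    by blast
  then show ?thesis
    using assms(1) unfolding finite_index_def by (meson finite_imageI finite_subset)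
qed

end

theorem theorem1p4:
  fixes s :: "'a::division_ring \<Rightarrow> 'a"
    and N G :: "'a set"
  assumes char_not_2: "(1::'a) + 1 \<noteq> 0"
    and inv: "k_involution s"
    and N_normal: "is_normal_subgroup N"
    and G_sub: "is_subgroup G" and GN: "G \<subseteq> N"
    and G_tf: "torsion_free G"
    and G_nbf: "nilpotent_by_finite G"
    and G_not_abf: "\<not> abelian_by_finite G"
    and G_star: "s ` G = G"
    and N_star: "s ` N = N"
  shows "\<exists>u\<in>N. \<exists>v\<in>N. s u = u \<and> s v = v \<and> free_pair u v"
proof -
  interpret ring_involution s
    using inv by unfold_locales (auto simp: k_involution_def)
  obtain H m where H: "is_subgroup H" "H \<subseteq> G" "lower_central H m = {1}" "finite_index H G"
    using G_nbf by (auto simp: nilpotent_by_finite_def nilpotent_sg_def)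
  \<comment> \<open>Intersecting with the image makes the nilpotent subgroup stable under
    \<open>s\<close>. The index remains finite, so \<open>L\<close> cannot be abelian.\<close>
  define L where "L = H \<inter> s ` H"
  have L: "is_subgroup L"
    using H(1) is_subgroup_image[OF H(1)] by (auto simp: is_subgroup_def L_def)
  have LG: "L \<subseteq> G" using H(2) by (auto simp: L_def)
  have "finite_index L G"
    unfolding L_def using H G_sub G_star
    by (intro finite_index_Int finite_index_image)
  then have nab: "\<not> abelian_sg L" using G_not_abf L LG by (auto simp: abelian_by_finite_def)
  have "lower_central L m \<subseteq> {1}" using lower_central_mono[of L H m] H(3) by (simp add: L_def)
  moreover have "1 \<in> lower_central L m" using L by (cases m) (auto simp: is_subgroup_def gen_subgroup.one)
  ultimately have nil: "lower_central L m = {1}" by blast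
  have tf: "torsion_free L" using G_tf LG by (auto simp: torsion_free_def)
  have sL: "s a \<in> L" if "a \<in> L" for a using that by (auto simp: L_def)
  obtain x y z where L': "x \<in> L" "y \<in> L" "z \<in> L" and
    *: "y * x = z * x * y" "z * x = x * z" "z * y = y * z" "z \<noteq> 1"
      "s x = x \<or> s x = inverse x" "s y = y \<or> s y = inverse y"
    using exists_quantum_pair[OF L sL tf nil nab] by blast
  interpret quantum_plane_involution x y z s
  proof
    show "x \<noteq> 0" "y \<noteq> 0" using L L' by (auto simp: is_subgroup_def units_mult_def)
    show "z ^ n \<noteq> 1" if "0 < n" for n
      using tf L'(3) *(4) that by (auto simp: torsion_free_def)
  qed (fact * char_not_2)+
  have "y \<in> N" using L' LG GN by blast
  then show ?thesis
    using N_star by (intro free_symmetric_pair[OF N_normal]) auto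
qed

end
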